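(* Let $p\in[1,\infty]$, and let $\{P_j(D)\}_{j=1}^N$, $P_j(D)=\sum_{|\alpha|\le l}a_{j\alpha}D^\alpha$, be a system of order $l$ of differential operators with constant coefficients on $\mathbb R^n$ that is weakly coercive in the isotropic Sobolev space $\overset{\circ}{W}{}^l_p(\mathbb R^n)$. Suppose that $n\ge2N+1$. If the map $P^l:=(P_1^l,\dots,P_N^l):\mathbb R^n\to\mathbb R^{2N}$ has finitely many zeros on the unit sphere $\mathbb S^{n-1}$, then $l$ is even.
   Context: Notation: $D_k=-i\,\partial/\partial x_k$; coefficients are complex; $P_j^l(\xi)=\sum_{|\alpha|=l}a_{j\alpha}\xi^\alpha$ is the principal symbol, and $P^l$ is viewed as a map into $\mathbb R^{2N}$ via real and imaginary parts. The system is weakly coercive in $\overset{\circ}{W}{}^l_p(\mathbb R^n)$ if there are constants $C_1,C_2$ such that $\sum_{|\alpha|<l}\|D^\alpha f\|_{L^p(\mathbb R^n)}\le C_1\sum_{j=1}^N\|P_j(D)f\|_{L^p(\mathbb R^n)}+C_2\|f\|_{L^p(\mathbb R^n)}$ for all $f\in C_0^\infty(\mathbb R^n)$.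
   Formalization: The order l = 1 is excluded: there every system is weakly coercive (C_1=0, C_2=1), and D_1+iD_2 on R^3 (n=3, N=1) has exactly two zeros of P^1 on the sphere although l = 1 is odd, so the claim fails. *)

theory Defs
  imports "HOL-Analysis.Analysis" "HOL-Probability.Essential_Supremum"
begin

(* A multi-index on R^n is a function 'n => nat. *)

definition order_mi :: "('n::finite \<Rightarrow> nat) \<Rightarrow> nat" where
  "order_mi \<alpha> = (\<Sum>k\<in>UNIV. \<alpha> k)"

lemma finite_order_mi_le: "finite {\<alpha> :: 'n::finite \<Rightarrow> nat. order_mi \<alpha> \<le> l}"
proof (rule finite_subset)
  show "{\<alpha> :: 'n \<Rightarrow> nat. order_mi \<alpha> \<le> l} \<subseteq> (UNIV :: 'n set) \<rightarrow>\<^sub>E {..l}"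
  proof
    fix \<alpha> :: "'n \<Rightarrow> nat" assume "\<alpha> \<in> {\<alpha>. order_mi \<alpha> \<le> l}"
    moreover have "\<alpha> k \<le> order_mi \<alpha>" for k
      unfolding order_mi_def by (rule member_le_sum) auto
    ultimately show "\<alpha> \<in> (UNIV :: 'n set) \<rightarrow>\<^sub>E {..l}"
      by (auto intro: order_trans)
  qed
qed (simp add: finite_PiE)

definition Dk :: "'n::finite \<Rightarrow> (real^'n \<Rightarrow> complex) \<Rightarrow> real^'n \<Rightarrow> complex" where
  "Dk k f = (\<lambda>x. - \<i> * vector_derivative (\<lambda>t. f (x + t *\<^sub>R axis k 1)) (at 0))"

(* The index type carries no order, so the coordinates are run through in an arbitrary fixed
   enumeration; on smooth functions the result does not depend on it. *)
definition D_mi :: "('n::finite \<Rightarrow> nat) \<Rightarrow> (real^'n \<Rightarrow> complex) \<Rightarrow> real^'n \<Rightarrow> complex" where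
  "D_mi \<alpha> f = foldr (\<lambda>k. Dk k ^^ \<alpha> k) (SOME ks. distinct ks \<and> set ks = (UNIV :: 'n set)) f"

(* Each iterated partial derivative, in any order of differentiation, is (Frechet)
   differentiable everywhere, hence continuous, and so the next partial derivatives exist. *)
definition smooth_fun :: "(real^'n::finite \<Rightarrow> complex) \<Rightarrow> bool" where
  "smooth_fun f \<longleftrightarrow> (\<forall>ks. foldr Dk ks f differentiable_on UNIV)"

definition test_functions :: "(real^'n::finite \<Rightarrow> complex) set" where
  "test_functions = {f. smooth_fun f \<and> compact (closure {x. f x \<noteq> 0})}"

(* Real-valued: it is applied below only to continuous functions with compact support,
   for which it is the usual finite L^p norm. *)
definition Lp_norm :: "ennreal \<Rightarrow> (real^'n::finite \<Rightarrow> complex) \<Rightarrow> real" where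
  "Lp_norm p f =
     (if p = \<infinity> then enn2real (esssup lborel (\<lambda>x. ennreal (norm (f x))))
      else (LINT x|lborel. norm (f x) powr enn2real p) powr (1 / enn2real p))"

definition diff_op ::
  "nat \<Rightarrow> (('n::finite \<Rightarrow> nat) \<Rightarrow> complex) \<Rightarrow> (real^'n \<Rightarrow> complex) \<Rightarrow> real^'n \<Rightarrow> complex" where
  "diff_op l a f = (\<lambda>x. \<Sum>\<alpha> | order_mi \<alpha> \<le> l. a \<alpha> * D_mi \<alpha> f x)"

definition principal_symbol ::
  "nat \<Rightarrow> (('n::finite \<Rightarrow> nat) \<Rightarrow> complex) \<Rightarrow> real^'n \<Rightarrow> complex" where
  "principal_symbol l a \<xi> =
     (\<Sum>\<alpha> | order_mi \<alpha> = l. a \<alpha> * complex_of_real (\<Prod>k\<in>UNIV. (\<xi> $ k) ^ \<alpha> k))"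

(* With N = CARD('m), the target real^('m + 'm) is R^(2N): the left summand indexes the
   real parts and the right one the imaginary parts. *)
definition principal_map ::
  "nat \<Rightarrow> ('m::finite \<Rightarrow> ('n::finite \<Rightarrow> nat) \<Rightarrow> complex) \<Rightarrow> real^'n \<Rightarrow> real^('m + 'm)" where
  "principal_map l a \<xi> =
     (\<chi> i. case i of Inl j \<Rightarrow> Re (principal_symbol l (a j) \<xi>)
                   | Inr j \<Rightarrow> Im (principal_symbol l (a j) \<xi>))"

(* For l = 1 the left-hand side is just Lp_norm p f, so every system is weakly coercive
   (C1 = 0, C2 = 1); the notion has content only for l >= 2. *)
definition weakly_coercive ::
  "ennreal \<Rightarrow> nat \<Rightarrow> ('m::finite \<Rightarrow> ('n::finite \<Rightarrow> nat) \<Rightarrow> complex) \<Rightarrow> bool" where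
  "weakly_coercive p l a \<longleftrightarrow>
     (\<exists>C1 C2 :: real. \<forall>f \<in> test_functions.
        (\<Sum>\<alpha> | order_mi \<alpha> < l. Lp_norm p (D_mi \<alpha> f))
          \<le> C1 * (\<Sum>j\<in>UNIV. Lp_norm p (diff_op l (a j) f)) + C2 * Lp_norm p f)"

end

theory Submission
  imports Defs "HOL-Homology.Invariance_of_Domain" "HOL-Computational_Algebra.Polynomial"
begin

text \<open>
  Testing weak coercivity on slowly modulated plane waves bounds all \<open>\<xi>^\<alpha>\<close> with
  \<open>|\<alpha>| < l\<close> by the full symbols \<open>P\<^sub>j(\<xi>)\<close>, so for \<open>l \<ge> 2\<close> the common zeros of the full
  symbols form a bounded set. Equivalently, the homogenisation
  \<open>F(s, \<xi>) = \<Sum> a\<^sub>\<alpha> s^(l - |\<alpha>|) \<xi>^\<alpha>\<close> has no zero with \<open>|\<xi>| = 1\<close> and \<open>0 < |s|\<close> small. As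
  \<open>F(0, \<cdot>) = P\<^sup>l\<close> has only finitely many zeros on the sphere, a small vector \<open>w\<close> can be chosen
  that is orthogonal to none of them, and then \<open>\<xi> \<mapsto> F(w \<bullet> \<xi>, \<xi>)\<close> has no zero on the sphere.
  It is homogeneous of degree \<open>l\<close> and maps into dimension \<open>2N < n\<close>, so for odd \<open>l\<close> it would
  contradict the Borsuk-Ulam theorem.

  The Borsuk-Ulam theorem is needed for homogeneous maps only: the degree mod 2 is
  computed by restriction to an equator, and the map is first pushed off a missed direction so that
  it preserves the equator; the restricted map is again homogeneous.
\<close>

section \<open>Degrees of odd homogeneous maps\<close>

lemma nsphere_eq_top_of_set:
  "nsphere m = top_of_set (topspace (nsphere m))"
  by (simp add: nsphere euclidean_product_topology)

lemma in_topspace_nsphere_iff: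
  "x \<in> topspace (nsphere m) \<longleftrightarrow> (\<Sum>i\<le>m. (x i)\<^sup>2) = 1 \<and> (\<forall>i>m. x i = 0)"
  by (auto simp: nsphere)

text \<open>Points of \<open>nsphere m\<close> are functions on all of nat that vanish beyond index
  \<open>m\<close>, hence the value 0 there. The components stay separate real functions, so that
  single ones can be modified before normalising.\<close>

definition normalize_upto :: "nat \<Rightarrow> (nat \<Rightarrow> 'a \<Rightarrow> real) \<Rightarrow> 'a \<Rightarrow> nat \<Rightarrow> real" where
  "normalize_upto m F x = (\<lambda>i. if i \<le> m then F i x / sqrt (\<Sum>j\<le>m. (F j x)\<^sup>2) else 0)"

lemma sum_squares_upto_pos:
  fixes F :: "nat \<Rightarrow> real"
  assumes "\<exists>i\<le>m. F i \<noteq> 0"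
  shows "(\<Sum>j\<le>m. (F j)\<^sup>2) > 0"
proof -
  obtain i where "i \<le> m" "F i \<noteq> 0" using assms by auto
  then show ?thesis by (intro sum_pos2[of _ i]) auto
qed

lemma normalize_upto_in_nsphere:
  assumes "\<exists>i\<le>m. F i x \<noteq> 0"
  shows "normalize_upto m F x \<in> topspace (nsphere m)"
proof -
  have "(\<Sum>j\<le>m. (F j x)\<^sup>2) > 0" by (rule sum_squares_upto_pos[OF assms])
  then show ?thesis
    by (simp add: in_topspace_nsphere_iff normalize_upto_def power_divide flip: sum_divide_distrib)
qed

lemma continuous_on_normalize_upto:
  fixes F :: "nat \<Rightarrow> 'a::topological_space \<Rightarrow> real"
  assumes "\<And>i. i \<le> m \<Longrightarrow> continuous_on S (F i)"
    and "\<And>x. x \<in> S \<Longrightarrow> \<exists>i\<le>m. F i x \<noteq> 0"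
  shows "continuous_on S (normalize_upto m F)"
proof (rule continuous_on_coordinatewise_then_product)
  fix i
  have nz: "sqrt (\<Sum>j\<le>m. (F j x)\<^sup>2) \<noteq> 0" if "x \<in> S" for x
    using sum_squares_upto_pos[of m "\<lambda>j. F j x"] assms(2)[OF that] by simp
  show "continuous_on S (\<lambda>x. normalize_upto m F x i)"
    using assms(1) nz by (cases "i \<le> m") (auto simp: normalize_upto_def intro!: continuous_intros)
qed

lemma continuous_map_normalize_upto:
  assumes "\<And>i. i \<le> m \<Longrightarrow> continuous_on (topspace (nsphere m)) (F i)"
    and "\<And>x. x \<in> topspace (nsphere m) \<Longrightarrow> \<exists>i\<le>m. F i x \<noteq> 0"
  shows "continuous_map (nsphere m) (nsphere m) (normalize_upto m F)"
  using continuous_on_normalize_upto[OF assms] normalize_upto_in_nsphere[OF assms(2)]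
  by (subst (1 2) nsphere_eq_top_of_set) auto

text \<open>The straight-line homotopy from \<open>F\<close> to \<open>G\<close>, normalised at each
  time: \<open>nz\<close> says exactly that the segments avoid the origin.\<close>

lemma Brouwer_degree2_normalize_upto_homotopy:
  assumes F: "\<And>i. i \<le> m \<Longrightarrow> continuous_on (topspace (nsphere m)) (F i)"
    and G: "\<And>i. i \<le> m \<Longrightarrow> continuous_on (topspace (nsphere m)) (G i)"
    and nz: "\<And>x t. \<lbrakk>x \<in> topspace (nsphere m); 0 \<le> t; t \<le> 1\<rbrakk>
               \<Longrightarrow> \<exists>i\<le>m. (1 - t) * F i x + t * G i x \<noteq> 0"
  shows "Brouwer_degree2 m (normalize_upto m F) = Brouwer_degree2 m (normalize_upto m G)"
proof (rule Brouwer_degree2_homotopic)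
  let ?S = "topspace (nsphere m)"
  define H where "H i z = (1 - fst z) * F i (snd z) + fst z * G i (snd z)" for i and z :: "real \<times> (nat \<Rightarrow> real)"
  have snd: "snd ` ({0..1} \<times> ?S) \<subseteq> ?S" by auto
  have cont: "continuous_on ({0..1} \<times> ?S) (H i)" if "i \<le> m" for i
    unfolding H_def
    by (intro continuous_intros continuous_on_compose2[OF F[OF that] _ snd]
          continuous_on_compose2[OF G[OF that] _ snd])
  have nzH: "\<exists>i\<le>m. H i z \<noteq> 0" if "z \<in> {0..1} \<times> ?S" for z
    using nz[of "snd z" "fst z"] that by (auto simp: H_def)
  have "homotopic_with (\<lambda>x. True) (top_of_set ?S) (top_of_set ?S) (normalize_upto m F) (normalize_upto m G)"
    unfolding homotopic_with[OF refl]
  proof (intro exI[of _ "normalize_upto m H"] conjI allI ballI)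
    show "continuous_map (prod_topology (top_of_set {0..1}) (top_of_set ?S)) (top_of_set ?S) (normalize_upto m H)"
    proof -
      have "normalize_upto m H z \<in> ?S" if "z \<in> {0..1} \<times> ?S" for z
        using normalize_upto_in_nsphere[of m H z] nzH[OF that] by blast
      then show ?thesis using continuous_on_normalize_upto[OF cont nzH] by auto
    qed
  qed (auto simp: normalize_upto_def H_def)
  then show "homotopic_with (\<lambda>x. True) (nsphere m) (nsphere m) (normalize_upto m F) (normalize_upto m G)"
    using nsphere_eq_top_of_set[of m] by simp
qed

text \<open>The sphere of dimension 0 has two points, so an odd self-map is the identity or the
  swap, of degree 1 or -1. This is the base case of the induction on dimension.\<close>

lemma odd_Brouwer_degree2_0:
  assumes f: "f \<in> topspace (nsphere 0) \<rightarrow> topspace (nsphere 0)"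
    and odd: "\<And>x. x \<in> topspace (nsphere 0) \<Longrightarrow> f (\<lambda>i. - x i) = (\<lambda>i. - f x i)"
  shows "odd (Brouwer_degree2 0 f)"
proof -
  define e :: "nat \<Rightarrow> real" where "e = (\<lambda>i. if i = 0 then 1 else 0)"
  have S: "x \<in> topspace (nsphere 0) \<longleftrightarrow> x = e \<or> x = (\<lambda>i. - e i)" for x
    by (auto simp: in_topspace_nsphere_iff e_def fun_eq_iff power2_eq_1_iff)
  have "f e = e \<or> f e = (\<lambda>i. - e i)" using f S by blast
  then show ?thesis
  proof
    assume "f e = e"
    then have "Brouwer_degree2 0 f = Brouwer_degree2 0 id"
      using odd[of e] by (intro Brouwer_degree2_eq) (auto simp: S)
    then show ?thesis by simp
  next
    assume "f e = (\<lambda>i. - e i)"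
    then have "Brouwer_degree2 0 f = Brouwer_degree2 0 (\<lambda>x i. if i = 0 then - x i else x i)"
      using odd[of e] by (intro Brouwer_degree2_eq) (auto simp: S e_def)
    then show ?thesis by (simp add: Brouwer_degree2_reflection)
  qed
qed

section \<open>Odd homogeneous maps on R^n and a Borsuk-Ulam theorem for them\<close>

text \<open>Through an enumeration \<open>e\<close> of the index type, every
  \<open>nsphere m\<close> with \<open>m < CARD('n)\<close> sits in the one space
  \<open>real^'n\<close>, inside the span of the first \<open>m + 1\<close> coordinates. The
  induction on \<open>m\<close> therefore never changes the type of the domain.\<close>

definition coord_vec :: "('n::finite \<Rightarrow> nat) \<Rightarrow> (nat \<Rightarrow> real) \<Rightarrow> real^'n" where
  "coord_vec e x = (\<chi> k. x (e k))"

lemma continuous_on_coord_vec: "continuous_on S (coord_vec e)"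
  unfolding coord_vec_def
  by (intro continuous_on_vec_lambda) (simp add: continuous_on_subset[OF continuous_on_product_coordinates])

lemma differentiable_on_vec_lambda:
  fixes f :: "real^'n \<Rightarrow> 'k::finite \<Rightarrow> real"
  assumes "\<And>k. (\<lambda>x. f x k) differentiable_on S"
  shows "(\<lambda>x. \<chi> k. f x k) differentiable_on S"
proof -
  have "(\<lambda>x. \<chi> k. f x k) = (\<lambda>x. \<Sum>k\<in>UNIV. f x k *\<^sub>R axis k 1)"
    by (simp add: fun_eq_iff vec_eq_iff axis_def if_distrib[of "\<lambda>a. b * a" for b] cong: if_cong)
  then show ?thesis
    using assms by (auto simp: differentiable_on_def intro!: differentiable_sum differentiable_scaleR)
qed

text \<open>The image of a cone of dimension \<^term>\<open>m\<close> under a homogeneous map into dimension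
  \<^term>\<open>Suc m\<close> is a null set, so some direction is missed; it can be normalised to have last
  coordinate 1. The coordinates beyond \<^term>\<open>m\<close> are carried along unchanged so that the
  null set argument can be run in the full space.\<close>

lemma homogeneous_map_misses_direction:
  fixes h :: "nat \<Rightarrow> real^'n \<Rightarrow> real"
  assumes e: "bij_betw e (UNIV :: 'n::finite set) {..<CARD('n)}"
    and m: "m < CARD('n)" and d: "odd d"
    and diff: "\<And>i. i \<le> m \<Longrightarrow> h i differentiable_on UNIV"
    and hom: "\<And>i c x. i \<le> m \<Longrightarrow> h i (c *\<^sub>R x) = c ^ d * h i x"
  shows "\<exists>q. \<forall>x. (\<forall>k. e k \<ge> m \<longrightarrow> x $ k = 0) \<longrightarrow> (\<forall>i<m. h i x = q i * h m x) \<longrightarrow> h m x = 0"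
proof -
  define P where "P z = (\<chi> k. if e k < m then z $ k else 0)" for z :: "real^'n"
  define \<phi> where "\<phi> z = (\<chi> k. if e k \<le> m then h (e k) (P z) else z $ k)" for z :: "real^'n"
  obtain k0 where k0: "e k0 = m" using e m by (metis bij_betw_iff_bijections lessThan_iff)
  have inj: "e k = e k' \<longleftrightarrow> k = k'" for k k' using e by (auto simp: bij_betw_def inj_on_def)
  define D where "D = {z :: real^'n. z $ k0 = 0}"
  have ne: "axis k0 1 \<noteq> (0 :: real^'n)" by (simp add: axis_eq_0_iff)
  have D: "negligible D"
    using negligible_hyperplane[of "axis k0 1 :: real^'n" 0] ne
    by (simp add: D_def inner_axis')
  have linP: "P differentiable_on UNIV" unfolding P_def
  proof (rule differentiable_on_vec_lambda)
    fix k
    show "(\<lambda>z :: real^'n. if e k < m then z $ k else 0) differentiable_on UNIV"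
      by (cases "e k < m")
        (simp_all add: linear_imp_differentiable_on[OF bounded_linear.linear[OF bounded_linear_vec_nth]])
  qed
  have "\<phi> differentiable_on UNIV" unfolding \<phi>_def
  proof (rule differentiable_on_vec_lambda)
    fix k
    show "(\<lambda>z. if e k \<le> m then h (e k) (P z) else z $ k) differentiable_on UNIV"
    proof (cases "e k \<le> m")
      case True
      then show ?thesis using differentiable_on_compose[OF linP, of "h (e k)"] diff[OF True]
        by (simp add: o_def differentiable_on_subset)
    next
      case False
      then show ?thesis
        by (auto intro!: linear_imp_differentiable_on bounded_linear.linear)
    qed
  qed
  then have "negligible (\<phi> ` D)"
    by (intro negligible_differentiable_image_negligible D) (auto intro: differentiable_on_subset)
  then have "negligible (\<phi> ` D \<union> D)" using D by simp
  \<comment> \<open>Avoiding \<open>D\<close> as well makes the coordinate \<open>k0\<close> of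
    \<open>z\<close> nonzero, so the missed vector can be divided by it; the quotients are
    \<open>q\<close>.\<close>
  then obtain z where z: "z \<notin> \<phi> ` D" "z \<notin> D" using non_negligible_UNIV by (metis UNIV_eq_I Un_iff)
  have z0: "z $ k0 \<noteq> 0" using z(2) by (simp add: D_def)
  define q where "q i = z $ (inv_into UNIV e i) / z $ k0" for i
  have inve: "inv_into UNIV e (e k) = k" for k by (rule inv_f_f) (auto simp: inj_on_def inj)
  show ?thesis
  proof (intro exI[of _ q] allI impI, rule ccontr)
    fix x :: "real^'n"
    assume x: "\<forall>k. e k \<ge> m \<longrightarrow> x $ k = 0" and eq: "\<forall>i<m. h i x = q i * h m x" and hm: "h m x \<noteq> 0"
    \<comment> \<open>As \<open>d\<close> is odd, a real root exists whatever the sign. By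
      homogeneity, \<open>h m\<close> takes the value \<open>z $ k0\<close> at
      \<open>c *\<^sub>R x\<close>, and the other components then match \<open>z\<close> as
      well.\<close>
    define c where "c = root d (z $ k0 / h m x)"
    have c: "c ^ d = z $ k0 / h m x" unfolding c_def by (rule odd_real_root_pow[OF d])
    \<comment> \<open>A preimage of \<open>z\<close> in \<open>D\<close>: the scaled
      \<open>x\<close> in the first \<open>m\<close> coordinates, 0 in coordinate \<open>k0\<close>,
      and those of \<open>z\<close> beyond, which \<open>\<phi>\<close> leaves alone.\<close>
    define w where "w = (\<chi> k. if e k < m then c * x $ k else if e k = m then 0 else z $ k)"
    have Pw: "P w = c *\<^sub>R x" using x by (auto simp: P_def w_def vec_eq_iff)
    have "\<phi> w = z"
    proof (simp add: \<phi>_def vec_eq_iff, intro conjI allI impI)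
      fix k
      { assume k: "e k \<le> m"
        have "h (e k) (P w) = c ^ d * h (e k) x" unfolding Pw by (rule hom[OF k])
        also have "\<dots> = z $ k"
        proof (cases "e k = m")
          case True
          then have "k = k0" using k0 inj by metis
          then show ?thesis using hm c k0 by simp
        next
          case False
          then have "h (e k) x = q (e k) * h m x" using eq k by auto
          then show ?thesis using hm c z0 by (simp add: q_def inve)
        qed
        finally show "h (e k) (P w) = z $ k" . }
      { assume "\<not> e k \<le> m" then show "w $ k = z $ k" by (auto simp: w_def) }
    qed
    moreover have "w \<in> D" using k0 by (simp add: D_def w_def)
    ultimately show False using z(1) by auto
  qed
qed

text \<open>Induction on \<open>m\<close>. A direction missed by the image of the equator allows a
  deformation, through maps without zeros, to an odd map that sends the equator to itself. On the
  equator that map is the normalisation of a homogeneous family of the same degree \<open>d\<close>,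
  to which the induction hypothesis applies.\<close>

theorem odd_Brouwer_degree2_homogeneous:
  fixes h :: "nat \<Rightarrow> real^'n \<Rightarrow> real"
  assumes e: "bij_betw e (UNIV :: 'n::finite set) {..<CARD('n)}"
    and m: "m < CARD('n)" and d: "odd d"
    and diff: "\<And>i. i \<le> m \<Longrightarrow> h i differentiable_on UNIV"
    and hom: "\<And>i c x. i \<le> m \<Longrightarrow> h i (c *\<^sub>R x) = c ^ d * h i x"
    and nz: "\<And>x. x \<in> topspace (nsphere m) \<Longrightarrow> \<exists>i\<le>m. h i (coord_vec e x) \<noteq> 0"
  shows "odd (Brouwer_degree2 m (normalize_upto m (\<lambda>i x. h i (coord_vec e x))))"
  using m diff hom nz
proof (induction m arbitrary: h)
  case (0 h)
  have odd: "h 0 (coord_vec e (\<lambda>i. - x i)) = - h 0 (coord_vec e x)" for x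
  proof -
    have "coord_vec e (\<lambda>i. - x i) = (-1) *\<^sub>R coord_vec e x" by (simp add: coord_vec_def vec_eq_iff)
    then show ?thesis using 0(3)[of 0 "-1" "coord_vec e x"] d by simp
  qed
  show ?case
  proof (rule odd_Brouwer_degree2_0)
    show "normalize_upto 0 (\<lambda>i x. h i (coord_vec e x)) \<in> topspace (nsphere 0) \<rightarrow> topspace (nsphere 0)"
      using 0(4) by (auto intro: normalize_upto_in_nsphere)
  qed (auto simp: normalize_upto_def odd)
next
  case (Suc m h)
  let ?S = "topspace (nsphere (Suc m))" and ?c = "coord_vec e"
  have coord_neg: "?c (\<lambda>i. - x i) = (-1) *\<^sub>R ?c x" for x by (simp add: coord_vec_def vec_eq_iff)
  obtain q where q: "\<And>x. (\<forall>k. e k \<ge> Suc m \<longrightarrow> x $ k = 0) \<Longrightarrow>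
      (\<forall>i<Suc m. h i x = q i * h (Suc m) x) \<Longrightarrow> h (Suc m) x = 0"
    using homogeneous_map_misses_direction[of e "Suc m" d h, OF e Suc.prems(1) d Suc.prems(2,3)] by metis
  \<comment> \<open>\<open>h'\<close> projects along the missed direction \<open>(q, 1)\<close> onto
    the hyperplane where the last component is 0. The last component of \<open>g\<close> vanishes on
    the equator; its factor is an absolute value so that \<open>g\<close> remains odd.\<close>
  define h' where "h' i x = h i x - q i * h (Suc m) x" for i x
  define g where "g i x = (if i \<le> m then h' i (?c x) else \<bar>x (Suc m)\<bar> * h (Suc m) (?c x))" for i x
  have equator: "x \<in> ?S \<and> x (Suc m) = 0 \<longleftrightarrow> x \<in> topspace (nsphere m)" for x
    by (auto simp: in_topspace_nsphere_iff) (metis Suc_lessI)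
  have e0: "\<forall>k. e k \<ge> Suc m \<longrightarrow> ?c x $ k = 0" if "x \<in> topspace (nsphere m)" for x
    using that by (auto simp: in_topspace_nsphere_iff coord_vec_def)
  \<comment> \<open>A common zero of the \<open>h'\<close> on the equator would put the vector
    \<open>h\<close> on the missed line, which forces \<open>h (Suc m)\<close> and then every
    component to vanish.\<close>
  have nz': "\<exists>i\<le>m. h' i (?c x) \<noteq> 0" if x: "x \<in> topspace (nsphere m)" for x
  proof (rule ccontr)
    assume "\<not> ?thesis"
    then have eq: "h i (?c x) = q i * h (Suc m) (?c x)" if "i < Suc m" for i
      using that by (auto simp: h'_def)
    have "h (Suc m) (?c x) = 0" using q[OF e0[OF x]] eq by blast
    with eq have "h i (?c x) = 0" if "i \<le> Suc m" for i using that by (cases "i = Suc m") auto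
    with Suc.prems(4)[of x] show False using x equator by blast
  qed
  have IH: "odd (Brouwer_degree2 m (normalize_upto m (\<lambda>i x. h' i (?c x))))"
  proof (rule Suc.IH[of h', OF _ _ _ nz'])
    show "m < CARD('n)" using Suc.prems(1) by simp
  qed (auto simp: h'_def Suc.prems algebra_simps
          intro!: differentiable_on_diff differentiable_on_mult differentiable_on_const)
  have conth: "continuous_on T (\<lambda>x. h i (?c x))" if "i \<le> Suc m" for i T
    using differentiable_imp_continuous_on[OF Suc.prems(2)[OF that]]
    by (rule continuous_on_compose2[OF _ continuous_on_coord_vec]) auto
  have contg: "continuous_on ?S (g i)" if "i \<le> Suc m" for i
    using that unfolding g_def h'_def
    by (cases "i \<le> m") (auto intro!: continuous_intros conth continuous_on_subset[OF continuous_on_product_coordinates])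
  \<comment> \<open>If \<open>h (Suc m)\<close> vanishes at the point, the remaining equations kill
    every \<open>h i\<close>. Otherwise the last equation leaves only \<open>t = 1\<close> on the
    equator, where the \<open>h'\<close> have no common zero.\<close>
  have nzt: "\<exists>i\<le>Suc m. (1 - t) * h i (?c x) + t * g i x \<noteq> 0" if x: "x \<in> ?S" and t: "0 \<le> t" "t \<le> 1" for x t
  proof (rule ccontr)
    assume "\<not> ?thesis"
    then have z: "(1 - t) * h i (?c x) + t * g i x = 0" if "i \<le> Suc m" for i using that by blast
    have last: "(1 - t + t * \<bar>x (Suc m)\<bar>) * h (Suc m) (?c x) = 0"
      using z[of "Suc m"] by (simp add: g_def algebra_simps)
    have first: "h i (?c x) = t * q i * h (Suc m) (?c x)" if "i \<le> m" for i
      using z[of i] that by (simp add: g_def h'_def algebra_simps)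
    show False
    proof (cases "h (Suc m) (?c x) = 0")
      case True
      then have "h i (?c x) = 0" if "i \<le> Suc m" for i
        using that first[of i] by (cases "i = Suc m") auto
      then show False using Suc.prems(4)[OF x] by blast
    next
      case False
      then have "1 - t + t * \<bar>x (Suc m)\<bar> = 0" using last by simp
      then have "t = 1" "x (Suc m) = 0" using t 
        by (smt (verit) mult_nonneg_nonneg abs_ge_zero mult_cancel_right1)+
      then show False using first nz' x equator by (auto simp: h'_def)
    qed
  qed
  have nzg: "\<exists>i\<le>Suc m. g i x \<noteq> 0" if "x \<in> ?S" for x using nzt[OF that, of 1] by simp
  have deg_eq: "Brouwer_degree2 (Suc m) (normalize_upto (Suc m) (\<lambda>i x. h i (?c x)))
      = Brouwer_degree2 (Suc m) (normalize_upto (Suc m) g)"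
    by (rule Brouwer_degree2_normalize_upto_homotopy) (use conth contg nzt in auto)
  have g_eq: "normalize_upto (Suc m) g x = normalize_upto m (\<lambda>i x. h' i (?c x)) x"
    if "x \<in> topspace (nsphere m)" for x
  proof -
    have "x (Suc m) = 0" using that equator by blast
    then show ?thesis by (auto simp: normalize_upto_def g_def fun_eq_iff le_Suc_eq)
  qed
  \<comment> \<open>An odd map preserving the equator has the same degree mod 2 on the sphere and on
    the equator.\<close>
  have "even (Brouwer_degree2 (Suc m) (normalize_upto (Suc m) g)
      - Brouwer_degree2 (Suc m - Suc 0) (normalize_upto (Suc m) g))"
  proof (rule Borsuk_odd_mapping_degree_step)
    show "continuous_map (nsphere (Suc m)) (nsphere (Suc m)) (normalize_upto (Suc m) g)"
      by (rule continuous_map_normalize_upto[OF contg nzg])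
    show "normalize_upto (Suc m) g \<in> topspace (nsphere (Suc m - Suc 0)) \<rightarrow> topspace (nsphere (Suc m - Suc 0))"
      using g_eq nz' normalize_upto_in_nsphere[of m "\<lambda>i x. h' i (?c x)"] by auto
    fix u assume "u \<in> ?S"
    have "g i (\<lambda>i. - u i) = - g i u" if "i \<le> Suc m" for i
      using that d Suc.prems(3)[of _ "-1" "?c u"]
      by (auto simp: g_def h'_def coord_neg algebra_simps)
    then show "(normalize_upto (Suc m) g \<circ> (\<lambda>x i. - x i)) u = ((\<lambda>x i. - x i) \<circ> normalize_upto (Suc m) g) u"
      by (auto simp: normalize_upto_def fun_eq_iff)
  qed
  moreover have "Brouwer_degree2 m (normalize_upto (Suc m) g)
      = Brouwer_degree2 m (normalize_upto m (\<lambda>i x. h' i (?c x)))"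
    by (rule Brouwer_degree2_eq[OF g_eq])
  ultimately show ?case using IH deg_eq by simp
qed

text \<open>Without a zero on the unit sphere, \<open>G\<close> padded with zero components
  normalises to a self-map of the sphere of dimension \<open>CARD('n) - 1\<close> with odd degree.
  Since \<open>CARD('k) < CARD('n)\<close>, its last component is identically 0, so it is not
  surjective and has degree 0.\<close>

theorem homogeneous_odd_common_zero:
  fixes G :: "real^'n::finite \<Rightarrow> real^'k::finite"
  assumes card: "CARD('k) < CARD('n)" and d: "odd d"
    and diff: "G differentiable_on UNIV"
    and hom: "\<And>c x. G (c *\<^sub>R x) = c ^ d *\<^sub>R G x"
  shows "\<exists>x. norm x = 1 \<and> G x = 0"
proof (rule ccontr)
  assume nex: "\<not> ?thesis"
  obtain e :: "'n \<Rightarrow> nat" where e: "bij_betw e UNIV {..<CARD('n)}"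
    using ex_bij_betw_finite_nat[OF finite[of "UNIV :: 'n set"]] by (auto simp: lessThan_atLeast0)
  obtain b :: "nat \<Rightarrow> 'k" where b: "bij_betw b {..<CARD('k)} UNIV"
    using ex_bij_betw_nat_finite[OF finite[of "UNIV :: 'k set"]] by (auto simp: lessThan_atLeast0)
  define m where "m = CARD('n) - 1"
  have m: "m < CARD('n)" "CARD('k) \<le> m" "{..m} = {..<CARD('n)}" using card by (auto simp: m_def)
  define h where "h i x = (if i < CARD('k) then G x $ b i else 0)" for i x
  let ?f = "normalize_upto m (\<lambda>i x. h i (coord_vec e x))"
  have nz: "\<exists>i\<le>m. h i (coord_vec e x) \<noteq> 0" if x: "x \<in> topspace (nsphere m)" for x
  proof -
    have "(\<Sum>k\<in>UNIV. (x (e k))\<^sup>2) = (\<Sum>i\<le>m. (x i)\<^sup>2)"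
      using sum.reindex_bij_betw[OF e, of "\<lambda>i. (x i)\<^sup>2"] m by simp
    then have "norm (coord_vec e x) = 1"
      using x by (simp add: in_topspace_nsphere_iff coord_vec_def norm_vec_def L2_set_def)
    then have "G (coord_vec e x) \<noteq> 0" using nex by blast
    then obtain k where "G (coord_vec e x) $ k \<noteq> 0" by (auto simp: vec_eq_iff)
    moreover obtain i where "i < CARD('k)" "b i = k"
      using b by (metis UNIV_I bij_betw_iff_bijections lessThan_iff)
    ultimately show ?thesis using m by (intro exI[of _ i]) (auto simp: h_def)
  qed
  have diffh: "h i differentiable_on UNIV" for i
  proof (cases "i < CARD('k)")
    case True
    have "(\<lambda>x. x $ b i) differentiable_on G ` UNIV"
      by (auto intro!: linear_imp_differentiable_on bounded_linear.linear)
    from differentiable_on_compose[OF diff this] show ?thesis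
      using True by (simp add: h_def[abs_def] o_def)
  qed (simp add: h_def[abs_def])
  have "odd (Brouwer_degree2 m ?f)"
    by (rule odd_Brouwer_degree2_homogeneous[OF e m(1) d diffh _ nz]) (auto simp: h_def hom)
  moreover have "Brouwer_degree2 m ?f = 0"
  proof (rule Brouwer_degree2_nonsurjective)
    have "continuous_on T (\<lambda>x. h i (coord_vec e x))" for i T
      using differentiable_imp_continuous_on[OF diffh[of i]]
      by (rule continuous_on_compose2[OF _ continuous_on_coord_vec]) auto
    then show "continuous_map (nsphere m) (nsphere m) ?f"
      by (intro continuous_map_normalize_upto nz) auto
    have "?f x m = 0" for x using m by (simp add: normalize_upto_def h_def)
    moreover have "(\<lambda>i. if i = m then 1 else 0) \<in> topspace (nsphere m)"
      by (auto simp: in_topspace_nsphere_iff if_distrib[of "\<lambda>a. a\<^sup>2"] cong: if_cong)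
    ultimately show "?f ` topspace (nsphere m) \<noteq> topspace (nsphere m)"
      by (metis (mono_tags, lifting) imageE zero_neq_one)
  qed
  ultimately show False by simp
qed

section \<open>Bump functions and crude Lp bounds\<close>

text \<open>The classical flat function \<open>exp (- (1 / t))\<close>, extended by 0, with a
  polynomial factor in \<open>1 / t\<close> that makes the family closed under
  differentiation.\<close>

definition flat_exp :: "real poly \<Rightarrow> real \<Rightarrow> real" where
  "flat_exp q t = (if t > 0 then poly q (1 / t) * exp (- (1 / t)) else 0)"

lemma poly_times_exp_minus_tendsto_0:
  fixes q :: "real poly"
  shows "((\<lambda>x. poly q x * exp (- x)) \<longlongrightarrow> 0) at_top"
proof -
  have "((\<lambda>x. \<Sum>i\<le>degree q. Polynomial.coeff q i * (x ^ i / exp x)) \<longlongrightarrow> (\<Sum>i\<le>degree q. Polynomial.coeff q i * 0)) at_top"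
    by (intro tendsto_sum tendsto_mult tendsto_const tendsto_power_div_exp_0)
  then show ?thesis
    by (simp add: poly_altdef exp_minus sum_divide_distrib divide_inverse sum_distrib_right mult.assoc)
qed

text \<open>With \<open>u = 1 / t\<close> one has \<open>du/dt = - u^2\<close>, so the product rule
  turns \<open>q(u) exp(-u)\<close> into \<open>u^2 (q(u) - q'(u)) exp(-u)\<close>; the polynomial
  \<open>[:0, 0, 1:]\<close> is the factor \<open>u^2\<close>.\<close>

lemma has_real_derivative_flat_exp:
  "(flat_exp q has_real_derivative flat_exp ([:0, 0, 1:] * (q - pderiv q)) t) (at t)"
proof -
  consider "t < 0" | "t = 0" | "t > 0" by linarith
  then show ?thesis
  proof cases
    case 1
    have "((\<lambda>t. 0) has_real_derivative 0) (at t)" by simp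
    then have "(flat_exp q has_real_derivative 0) (at t)"
      by (rule has_field_derivative_transform_within_open[of _ _ _ "{..<0}"])
        (use 1 in \<open>auto simp: flat_exp_def\<close>)
    then show ?thesis using 1 by (simp add: flat_exp_def)
  next
    case 2
    \<comment> \<open>For \<open>h > 0\<close> the difference quotient at 0 is
      \<open>u q(u) exp(-u)\<close> with \<open>u = 1 / h\<close> tending to infinity, since
      \<open>flat_exp\<close> is 0 at 0.\<close>
    have "((\<lambda>h. poly ([:0, 1:] * q) (inverse h) * exp (- inverse h)) \<longlongrightarrow> 0) (at_right 0)"
      by (rule filterlim_compose[OF poly_times_exp_minus_tendsto_0 filterlim_inverse_at_top_right])
    moreover have "\<forall>\<^sub>F h :: real in at_right 0. poly ([:0, 1:] * q) (inverse h) * exp (- inverse h)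
        = (flat_exp q (0 + h) - flat_exp q 0) / h"
      using eventually_at_right_less[of 0] by eventually_elim (simp add: flat_exp_def field_simps)
    ultimately have "((\<lambda>h. (flat_exp q (0 + h) - flat_exp q 0) / h) \<longlongrightarrow> 0) (at_right 0)"
      by (rule Lim_transform_eventually)
    moreover have "((\<lambda>h. (flat_exp q (0 + h) - flat_exp q 0) / h) \<longlongrightarrow> 0) (at_left 0)"
    proof (rule tendsto_eventually)
      show "\<forall>\<^sub>F h in at_left 0. (flat_exp q (0 + h) - flat_exp q 0) / h = 0"
        by (simp add: flat_exp_def eventually_at_filter)
    qed
    ultimately show ?thesis
      using 2 by (auto simp: DERIV_def flat_exp_def filterlim_split_at)
  next
    case 3
    have "((\<lambda>t. poly q (1 / t) * exp (- (1 / t))) has_real_derivative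
        flat_exp ([:0, 0, 1:] * (q - pderiv q)) t) (at t)"
      using 3 by (auto intro!: derivative_eq_intros poly_DERIV[THEN DERIV_chain2]
          simp: flat_exp_def field_simps power2_eq_square)
    then show ?thesis
      by (rule has_field_derivative_transform_within_open[of _ _ _ "{0<..}"])
        (use 3 in \<open>auto simp: flat_exp_def\<close>)
  qed
qed

text \<open>The Leibniz rule left unexpanded: when \<open>f (Suc i)\<close> and
  \<open>g (Suc j)\<close> are the derivatives of \<open>f i\<close> and \<open>g j\<close>, this is
  the \<open>n\<close>-th derivative of \<open>f i * g j\<close>, with no binomial coefficients to
  handle.\<close>

primrec product_derivs ::
  "(nat \<Rightarrow> real \<Rightarrow> real) \<Rightarrow> (nat \<Rightarrow> real \<Rightarrow> real) \<Rightarrow> nat \<Rightarrow> nat \<Rightarrow> nat \<Rightarrow> real \<Rightarrow> real" where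
  "product_derivs f g 0 i j t = f i t * g j t"
| "product_derivs f g (Suc n) i j t = product_derivs f g n (Suc i) j t + product_derivs f g n i (Suc j) t"

lemma has_real_derivative_product_derivs:
  assumes "\<And>i t. (f i has_real_derivative f (Suc i) t) (at t)"
    and "\<And>i t. (g i has_real_derivative g (Suc i) t) (at t)"
  shows "(product_derivs f g n i j has_real_derivative product_derivs f g (Suc n) i j t) (at t)"
proof (induction n arbitrary: i j)
  case 0
  have "((\<lambda>t. f i t * g j t) has_real_derivative f (Suc i) t * g j t + f i t * g (Suc j) t) (at t)"
    using assms by (auto intro!: derivative_eq_intros)
  then show ?case by simp
next
  case (Suc n)
  show ?case using DERIV_add[OF Suc[of "Suc i" j] Suc[of i "Suc j"]] by simp
qed

text \<open>The bump is \<open>exp (- 1/(1 - t)) * exp (- 1/(1 + t))\<close> on (-1, 1) and 0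
  outside. Compactness supplies both the bounds \<open>M j\<close> and the positive minimum
  \<open>c\<close> on [-1/2, 1/2].\<close>

lemma bump_function_derivs:
  obtains B :: "nat \<Rightarrow> real \<Rightarrow> real" and c :: real and M :: "nat \<Rightarrow> real"
  where "\<And>j t. (B j has_real_derivative B (Suc j) t) (at t)"
    and "\<And>j t. \<bar>t\<bar> \<ge> 1 \<Longrightarrow> B j t = 0"
    and "\<And>j t. \<bar>B j t\<bar> \<le> M j"
    and "c > 0" and "\<And>t. \<bar>t\<bar> \<le> 1/2 \<Longrightarrow> c \<le> B 0 t"
proof -
  \<comment> \<open>\<open>q j\<close> is the polynomial in the \<open>j\<close>-th derivative of
    the flat function; the sign in \<open>f\<close> comes from the inner function
    \<open>1 - t\<close>.\<close>
  define q :: "nat \<Rightarrow> real poly" where "q j = ((\<lambda>q. [:0, 0, 1:] * (q - pderiv q)) ^^ j) [:1:]" for j :: nat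
  define f where "f j t = (-1) ^ j * flat_exp (q j) (1 - t)" for j t
  define g where "g j t = flat_exp (q j) (1 + t)" for j t
  define B where "B n t = product_derivs f g n 0 0 t" for n t
  have flat: "(flat_exp (q j) has_real_derivative flat_exp (q (Suc j)) t) (at t)" for j t
    using has_real_derivative_flat_exp[of "q j" t] by (simp add: q_def)
  have f: "(f j has_real_derivative f (Suc j) t) (at t)" for j t
    unfolding f_def by (auto intro!: derivative_eq_intros DERIV_chain2[OF flat])
  have g: "(g j has_real_derivative g (Suc j) t) (at t)" for j t
    unfolding g_def by (auto intro!: derivative_eq_intros DERIV_chain2[OF flat, THEN DERIV_cong])
  have deriv: "(B j has_real_derivative B (Suc j) t) (at t)" for j t
    using has_real_derivative_product_derivs[of f g j 0 0 t, OF f g] unfolding B_def .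
  have "product_derivs f g n i j t = 0" if "\<bar>t\<bar> \<ge> 1" for n i j t
    using that by (induction n arbitrary: i j) (auto simp: f_def g_def flat_exp_def)
  then have supp: "B j t = 0" if "\<bar>t\<bar> \<ge> 1" for j t using that by (simp add: B_def)
  have contB: "continuous_on S (B j)" for j S
    using deriv[of j] by (meson DERIV_continuous continuous_at_imp_continuous_on)
  have "\<exists>M. \<forall>t. \<bar>B j t\<bar> \<le> M" for j
  proof -
    have "bounded (B j ` {-1..1})"
      by (intro compact_imp_bounded compact_continuous_image contB compact_Icc)
    then obtain M where M: "\<forall>t\<in>{-1..1}. \<bar>B j t\<bar> \<le> M" by (auto simp: bounded_iff)
    have "\<bar>B j t\<bar> \<le> max M 0" for t
    proof (cases "\<bar>t\<bar> \<ge> 1")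
      case False
      then have "t \<in> {-1..1}" by auto
      then show ?thesis using M by (meson max.coboundedI1)
    qed (simp add: supp)
    then show ?thesis by blast
  qed
  then obtain M where M: "\<bar>B j t\<bar> \<le> M j" for j t by metis
  have pos: "B 0 t > 0" if "t \<in> {-1/2..1/2}" for t
    using that by (auto simp: B_def f_def g_def q_def flat_exp_def)
  obtain t0 where t0: "t0 \<in> {-1/2..1/2 :: real}" "\<And>t. t \<in> {-1/2..1/2} \<Longrightarrow> B 0 t0 \<le> B 0 t"
    using continuous_attains_inf[of "{-1/2..1/2}" "B 0"] contB by auto
  show ?thesis
  proof (rule that[of B M "B 0 t0"])
    show "B 0 t0 \<le> B 0 t" if "\<bar>t\<bar> \<le> 1 / 2" for t
      using that by (intro t0(2)) auto
  qed (use deriv supp M pos[OF t0(1)] in auto)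
qed

text \<open>Only the size of the support enters here, so no Minkowski inequality is needed later.\<close>

definition Lp_factor :: "ennreal \<Rightarrow> (real^'n::finite) set \<Rightarrow> real" where
  "Lp_factor p S = (if p = \<infinity> then 1 else measure lborel S powr (1 / enn2real p))"

lemma enn2real_ge_1:
  assumes "1 \<le> p" "p \<noteq> \<infinity>"
  shows "1 \<le> enn2real p"
  using assms enn2real_mono[of 1 p] by (simp add: top.not_eq_extremum)

lemma Lp_norm_le:
  fixes f :: "real^'n::finite \<Rightarrow> complex"
  assumes p: "1 \<le> p" and f: "f \<in> borel_measurable borel"
    and S: "S \<in> sets lborel" "emeasure lborel S < \<infinity>" and M: "0 \<le> M"
    and le: "\<And>x. norm (f x) \<le> M * indicator S x"
  shows "Lp_norm p f \<le> M * Lp_factor p S"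
proof (cases "p = \<infinity>")
  case True
  have "norm (f x) \<le> M" for x
    using le[of x] M by (cases "x \<in> S") auto
  then have "esssup lborel (\<lambda>x. ennreal (norm (f x))) \<le> ennreal M"
    using f by (intro esssup_I) (auto intro!: ennreal_leI)
  then have "enn2real (esssup lborel (\<lambda>x. ennreal (norm (f x)))) \<le> enn2real (ennreal M)"
    by (intro enn2real_mono) auto
  then show ?thesis using True M by (simp add: Lp_norm_def Lp_factor_def)
next
  case False
  define q where "q = enn2real p"
  have q: "1 \<le> q" using enn2real_ge_1[OF p False] by (simp add: q_def)
  have int: "integrable lborel (\<lambda>x. M powr q * indicator S x)"
    using S by (intro integrable_mult_right) (simp add: integrable_indicator_iff)
  have pw: "norm (f x) powr q \<le> M powr q * indicator S x" for x
    using le[of x] q M powr_mono2[of q "norm (f x)" M] by (cases "x \<in> S") auto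
  have "(LINT x|lborel. norm (f x) powr q) \<le> (LINT x|lborel. M powr q * indicator S x)"
  proof (rule integral_mono[OF _ int pw])
    show "integrable lborel (\<lambda>x. norm (f x) powr q)"
      by (rule Bochner_Integration.integrable_bound[OF int]) (use f pw in auto)
  qed
  also have "\<dots> = M powr q * measure lborel S" using S by simp
  finally have "(LINT x|lborel. norm (f x) powr q) powr (1 / q) \<le> (M powr q * measure lborel S) powr (1 / q)"
    using q by (intro powr_mono2) auto
  also have "\<dots> = M * measure lborel S powr (1 / q)"
    using q M by (simp add: powr_mult powr_powr)
  finally show ?thesis using False by (simp add: Lp_norm_def Lp_factor_def q_def)
qed

text \<open>The majorant \<open>M * indicator S\<close> secures finiteness: a non-integrable
  function has integral 0 and \<open>enn2real\<close> sends infinity to 0, so a lower bound on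
  \<open>f\<close> alone would give nothing.\<close>

lemma Lp_norm_ge:
  fixes f :: "real^'n::finite \<Rightarrow> complex"
  assumes p: "1 \<le> p" and f: "f \<in> borel_measurable borel"
    and S: "S \<in> sets lborel" "emeasure lborel S < \<infinity>" and le: "\<And>x. norm (f x) \<le> M * indicator S x"
    and T: "T \<in> sets lborel" "emeasure lborel T < \<infinity>" "emeasure lborel T \<noteq> 0"
    and m: "0 \<le> m" and ge: "\<And>x. x \<in> T \<Longrightarrow> m \<le> norm (f x)"
  shows "m * Lp_factor p T \<le> Lp_norm p f"
proof (cases "p = \<infinity>")
  case True
  let ?E = "esssup lborel (\<lambda>x. ennreal (norm (f x)))"
  have "norm (f x) \<le> \<bar>M\<bar>" for x
    using le[of x] by (cases "x \<in> S") auto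
  then have "?E \<le> ennreal \<bar>M\<bar>"
    using f by (intro esssup_I) (auto intro!: ennreal_leI)
  then have fin: "?E < \<infinity>" by (rule order.strict_trans1) simp
  \<comment> \<open>Otherwise almost every point lies outside \<open>T\<close>, and \<open>T\<close>
    would be a null set.\<close>
  have "ennreal m \<le> ?E"
  proof (rule ccontr)
    assume less: "\<not> ?thesis"
    have "AE x in lborel. ennreal (norm (f x)) \<le> ?E"
      by (rule esssup_AE)
    then have "AE x in lborel. x \<notin> T"
    proof eventually_elim
      case (elim x)
      show ?case
      proof
        assume "x \<in> T"
        then have "ennreal m \<le> ennreal (norm (f x))" using ge by (intro ennreal_leI) auto
        with elim less show False by (meson order_trans)
      qed
    qed
    then have "T \<in> null_sets lborel" using T(1) by (subst (asm) AE_iff_null_sets[symmetric]) auto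
    then show False using T(3) by auto
  qed
  then have "m \<le> enn2real ?E"
    using fin m enn2real_mono[of "ennreal m" ?E] by simp
  then show ?thesis using True by (simp add: Lp_norm_def Lp_factor_def)
next
  case False
  define q where "q = enn2real p"
  have q: "1 \<le> q" using enn2real_ge_1[OF p False] by (simp add: q_def)
  have intT: "integrable lborel (\<lambda>x. m powr q * indicator T x)"
    using T by (intro integrable_mult_right) (simp add: integrable_indicator_iff)
  have int: "integrable lborel (\<lambda>x. \<bar>M\<bar> powr q * indicator S x)"
    using S by (intro integrable_mult_right) (simp add: integrable_indicator_iff)
  have pw: "norm (f x) powr q \<le> \<bar>M\<bar> powr q * indicator S x" for x
    using le[of x] q powr_mono2[of q "norm (f x)" "\<bar>M\<bar>"] by (cases "x \<in> S") auto
  have "m powr q * measure lborel T = (LINT x|lborel. m powr q * indicator T x)" using T by simp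
  also have "\<dots> \<le> (LINT x|lborel. norm (f x) powr q)"
  proof (rule integral_mono[OF intT])
    show "integrable lborel (\<lambda>x. norm (f x) powr q)"
      by (rule Bochner_Integration.integrable_bound[OF int]) (use f pw in auto)
    show "m powr q * indicator T x \<le> norm (f x) powr q" for x
      using ge[of x] m q by (cases "x \<in> T") (auto intro: powr_mono2)
  qed
  finally have "(m powr q * measure lborel T) powr (1 / q) \<le> (LINT x|lborel. norm (f x) powr q) powr (1 / q)"
    using q by (intro powr_mono2) auto
  moreover have "(m powr q * measure lborel T) powr (1 / q) = m * measure lborel T powr (1 / q)"
    using q m by (simp add: powr_mult powr_powr)
  ultimately show ?thesis using False by (simp add: Lp_norm_def Lp_factor_def q_def)
qed

section \<open>Cubes, the supports of products of functions of one coordinate\<close>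

definition cube :: "real \<Rightarrow> (real^'n::finite) set" where
  "cube r = {x. \<forall>k. \<bar>x $ k\<bar> \<le> r}"

lemma cube_eq_cbox: "cube r = cbox (\<chi> k. - r) (\<chi> k. r)"
  by (auto simp: cube_def mem_box_cart abs_le_iff) (metis minus_le_iff)+

lemma emeasure_cube:
  assumes "0 \<le> r"
  shows "emeasure lborel (cube r :: (real^'n::finite) set) = ennreal ((2 * r) ^ CARD('n))"
proof -
  have "measure lborel (cbox (\<chi> k. - r) (\<chi> k. r) :: (real^'n) set) = (2 * r) ^ CARD('n)"
    using assms by (subst content_cbox_cart) (auto simp: mem_box_cart intro!: exI[of _ 0] simp flip: ex_in_conv)
  moreover have "emeasure lborel (cbox (\<chi> k. - r) (\<chi> k. r) :: (real^'n) set) \<noteq> \<infinity>"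
    using emeasure_lborel_cbox_finite by (metis infinity_ennreal_def less_irrefl)
  ultimately show ?thesis by (simp add: cube_eq_cbox emeasure_eq_ennreal_measure)
qed

lemma sets_cube [measurable]: "cube r \<in> sets borel"
  by (simp add: cube_eq_cbox)

lemma Lp_factor_cube_pos:
  assumes "0 < r"
  shows "0 < Lp_factor p (cube r :: (real^'n::finite) set)"
  using assms emeasure_cube[of r, where 'n='n] by (simp add: Lp_factor_def measure_def)

text \<open>For finite \<open>p\<close> the two factors have ratio \<open>2^(n/p)\<close>, at most
  \<open>2^n\<close> because \<open>1 \<le> p\<close>; for infinite \<open>p\<close> both are 1. The
  bound is free of \<open>r\<close>, so it survives the limit of large \<open>r\<close>.\<close>

lemma Lp_factor_cube_half:
  assumes "1 \<le> p" "0 < r"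
  shows "Lp_factor p (cube r :: (real^'n::finite) set) \<le> 2 ^ CARD('n) * Lp_factor p (cube (r/2) :: (real^'n) set)"
proof (cases "p = \<infinity>")
  case False
  define q where "q = enn2real p"
  have q: "1 \<le> q" using enn2real_ge_1[OF assms(1) False] by (simp add: q_def)
  have "((2 * r) ^ CARD('n)) powr (1 / q) = (2 ^ CARD('n)) powr (1 / q) * (r ^ CARD('n)) powr (1 / q)"
    using assms by (simp add: power_mult_distrib powr_mult)
  also have "\<dots> \<le> 2 ^ CARD('n) * (r ^ CARD('n)) powr (1 / q)"
    using q powr_mono[of "1 / q" 1 "2 ^ CARD('n)"] by (intro mult_right_mono) auto
  finally show ?thesis
    using False assms emeasure_cube[of r, where 'n='n] emeasure_cube[of "r/2", where 'n='n]
    by (simp add: Lp_factor_def measure_def q_def)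
qed (simp add: Lp_factor_def)

section \<open>Modulated plane waves\<close>

text \<open>\<open>U k j\<close> plays the role of \<open>(-i d/dt)^j\<close> applied to the factor
  in coordinate \<open>k\<close>. Differentiating the product then only shifts the
  multi-index.\<close>

definition coord_prod :: "('n::finite \<Rightarrow> nat \<Rightarrow> real \<Rightarrow> complex) \<Rightarrow> ('n \<Rightarrow> nat) \<Rightarrow> real^'n \<Rightarrow> complex" where
  "coord_prod U \<alpha> x = (\<Prod>k\<in>UNIV. U k (\<alpha> k) (x $ k))"

lemma coord_prod_eq_0:
  assumes "\<And>k j t. \<bar>t\<bar> > r \<Longrightarrow> U k j t = 0" and "x \<notin> cube r"
  shows "coord_prod U \<alpha> x = 0"
  using assms by (auto simp: coord_prod_def cube_def not_le)

context
  fixes U :: "'n::finite \<Rightarrow> nat \<Rightarrow> real \<Rightarrow> complex"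
  assumes U: "\<And>k j t. (U k j has_vector_derivative \<i> * U k (Suc j) t) (at t)"
begin

lemma Dk_coord_prod: "Dk k (coord_prod U \<alpha>) = coord_prod U (\<alpha>(k := Suc (\<alpha> k)))"
proof
  fix x
  let ?c = "\<Prod>j\<in>UNIV - {k}. U j (\<alpha> j) (x $ j)"
  have split: "(\<Prod>j\<in>UNIV. f j) = f k * (\<Prod>j\<in>UNIV - {k}. f j)" for f :: "'n \<Rightarrow> complex"
    by (rule prod.remove) auto
  have eq: "(\<lambda>t. coord_prod U \<alpha> (x + t *\<^sub>R axis k 1)) = (\<lambda>t. U k (\<alpha> k) (x $ k + t) * ?c)"
    by (simp add: fun_eq_iff coord_prod_def split axis_def)
  have "((\<lambda>t. U k (\<alpha> k) (x $ k + t)) has_vector_derivative \<i> * U k (Suc (\<alpha> k)) (x $ k)) (at 0)"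
  proof -
    have "((\<lambda>t. x $ k + t) has_vector_derivative 1) (at 0)" by (auto intro!: derivative_eq_intros)
    from vector_diff_chain_at[OF this U] show ?thesis by (simp add: o_def)
  qed
  then have "((\<lambda>t. coord_prod U \<alpha> (x + t *\<^sub>R axis k 1)) has_vector_derivative \<i> * U k (Suc (\<alpha> k)) (x $ k) * ?c) (at 0)"
    unfolding eq by (rule has_vector_derivative_mult_left)
  then show "Dk k (coord_prod U \<alpha>) x = coord_prod U (\<alpha>(k := Suc (\<alpha> k))) x"
    using split[of "\<lambda>j. U j ((\<alpha>(k := Suc (\<alpha> k))) j) (x $ j)"]
    by (simp add: Dk_def vector_derivative_at coord_prod_def mult.assoc[symmetric])
qed

text \<open>Closure of the family under partial derivatives in any order, which reduces smoothness
  to differentiability of each member.\<close>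

lemma foldr_Dk_coord_prod: "\<exists>\<beta>. foldr Dk ks (coord_prod U \<alpha>) = coord_prod U \<beta>"
  by (induction ks) (auto simp: Dk_coord_prod)

lemma funpow_Dk_coord_prod: "(Dk k ^^ j) (coord_prod U \<alpha>) = coord_prod U (\<alpha>(k := \<alpha> k + j))"
proof (induction j)
  case (Suc j)
  have "(\<alpha>(k := \<alpha> k + j))(k := Suc (\<alpha> k + j)) = \<alpha>(k := \<alpha> k + Suc j)" by auto
  then show ?case by (simp only: funpow.simps o_apply Suc Dk_coord_prod fun_upd_same)
qed (simp only: funpow_0 add_0_right fun_upd_triv)

lemma D_mi_coord_prod: "D_mi \<alpha> (coord_prod U (\<lambda>_. 0)) = coord_prod U \<alpha>"
proof -
  define ks where "ks = (SOME ks. distinct ks \<and> set ks = (UNIV :: 'n set))"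
  have ks: "distinct ks" "set ks = (UNIV :: 'n set)"
    using someI_ex[OF finite_distinct_list[OF finite[of "UNIV :: 'n set"]]]
    by (auto simp: ks_def conj_commute)
  \<comment> \<open>The enumeration in \<open>D_mi\<close> is an arbitrary choice, so the induction
    runs over every list without repetitions, with \<open>\<alpha>\<close> cut down to the
    coordinates treated so far.\<close>
  have "foldr (\<lambda>k. Dk k ^^ \<alpha> k) ls (coord_prod U (\<lambda>_. 0)) = coord_prod U (\<lambda>k. if k \<in> set ls then \<alpha> k else 0)"
    if "distinct ls" for ls
    using that
  proof (induction ls)
    case (Cons b ls)
    let ?\<beta> = "\<lambda>k. if k \<in> set ls then \<alpha> k else 0"
    have "?\<beta>(b := ?\<beta> b + \<alpha> b) = (\<lambda>k. if k \<in> set (b # ls) then \<alpha> k else 0)" using Cons.prems by auto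
    moreover have "foldr (\<lambda>k. Dk k ^^ \<alpha> k) ls (coord_prod U (\<lambda>_. 0)) = coord_prod U ?\<beta>"
      using Cons by simp
    ultimately show ?case by (simp only: foldr_Cons o_apply funpow_Dk_coord_prod)
  qed simp
  from this[OF ks(1)] show ?thesis using ks(2) by (simp add: D_mi_def ks_def)
qed

lemma differentiable_on_coord_prod: "coord_prod U \<alpha> differentiable_on UNIV"
proof -
  have "((\<lambda>x. U k (\<alpha> k) (x $ k)) has_derivative (\<lambda>h. h $ k *\<^sub>R (\<i> * U k (Suc (\<alpha> k)) (x $ k)))) (at x)" for k and x :: "real^'n"
    using has_derivative_compose[OF bounded_linear.has_derivative[OF bounded_linear_vec_nth has_derivative_ident]
        U[unfolded has_vector_derivative_def]] .
  then have "(coord_prod U \<alpha> has_derivative (\<lambda>y. \<Sum>k\<in>UNIV. y $ k *\<^sub>R (\<i> * U k (Suc (\<alpha> k)) (x $ k)) *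
      (\<Prod>j\<in>UNIV - {k}. U j (\<alpha> j) (x $ j)))) (at x)" for x
    unfolding coord_prod_def by (intro has_derivative_prod)
  then show ?thesis by (auto simp: differentiable_on_def differentiable_def)
qed

lemma coord_prod_in_test_functions:
  assumes "\<And>k j t. \<bar>t\<bar> > r \<Longrightarrow> U k j t = 0"
  shows "coord_prod U \<alpha> \<in> test_functions"
proof -
  have "smooth_fun (coord_prod U \<alpha>)"
    using foldr_Dk_coord_prod differentiable_on_coord_prod unfolding smooth_fun_def by metis
  moreover have "bounded {x. coord_prod U \<alpha> x \<noteq> 0}"
    by (rule bounded_subset[of "cube r"])
      (use coord_prod_eq_0[where U=U and r=r, OF assms] in \<open>auto simp: cube_eq_cbox[symmetric] intro: bounded_subset[OF bounded_cbox eq_refl[OF cube_eq_cbox]]\<close>)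
  ultimately show ?thesis by (simp add: test_functions_def)
qed

lemma borel_measurable_coord_prod: "coord_prod U \<alpha> \<in> borel_measurable borel"
  by (intro borel_measurable_continuous_onI differentiable_imp_continuous_on differentiable_on_coord_prod)

end

text \<open>If \<^term>\<open>B j\<close> is the \<^term>\<open>j\<close>-th derivative of a bump function, then
  \<open>(-i d/dt)^n (B 0 (t/r) exp (izt)) = modulated_derivs B r z n 0 (t/r) exp (izt)\<close>.\<close>

primrec modulated_derivs :: "(nat \<Rightarrow> real \<Rightarrow> real) \<Rightarrow> real \<Rightarrow> real \<Rightarrow> nat \<Rightarrow> nat \<Rightarrow> real \<Rightarrow> complex" where
  "modulated_derivs B r z 0 j s = of_real (B j s)"
| "modulated_derivs B r z (Suc n) j s =
     of_real z * modulated_derivs B r z n j s - \<i> / of_real r * modulated_derivs B r z n (Suc j) s"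

lemma has_vector_derivative_modulated_derivs:
  assumes "\<And>j t. (B j has_real_derivative B (Suc j) t) (at t)"
  shows "(modulated_derivs B r z n j has_vector_derivative modulated_derivs B r z n (Suc j) s) (at s)"
proof (induction n arbitrary: j)
  case 0
  then show ?case using has_vector_derivative_of_real[OF assms] by simp
next
  case (Suc n)
  show ?case
    using has_vector_derivative_diff[OF has_vector_derivative_mult_right[OF Suc[of j], of "of_real z"]
        has_vector_derivative_mult_right[OF Suc[of "Suc j"], of "\<i> / of_real r"]]
    by simp
qed

lemma modulated_derivs_eq_0:
  assumes "\<And>j t. \<bar>t\<bar> \<ge> 1 \<Longrightarrow> B j t = 0" "\<bar>s\<bar> \<ge> 1"
  shows "modulated_derivs B r z n j s = 0"
  by (induction n arbitrary: j) (auto simp: assms)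

text \<open>Each derivative that falls on the cutoff costs a factor \<open>1 / r\<close>; when all
  fall on the exponential, the result is \<open>z ^ n\<close>. The restriction
  \<open>r \<ge> 1\<close> lets error terms be absorbed into constants free of \<open>r\<close> and
  \<open>s\<close>.\<close>

lemma modulated_derivs_approx:
  assumes B: "\<And>j t. \<bar>B j t\<bar> \<le> M j"
  shows "\<exists>C. \<forall>r\<ge>1. \<forall>s. norm (modulated_derivs B r z n j s - of_real (z ^ n * B j s)) \<le> C / r"
proof (induction n arbitrary: j)
  case 0
  show ?case by (rule exI[of _ 0]) simp
next
  case (Suc n)
  obtain C where C: "\<And>r s. r \<ge> 1 \<Longrightarrow> norm (modulated_derivs B r z n j s - of_real (z ^ n * B j s)) \<le> C / r"
    using Suc[of j] by blast
  obtain C' where C': "\<And>r s. r \<ge> 1 \<Longrightarrow> norm (modulated_derivs B r z n (Suc j) s - of_real (z ^ n * B (Suc j) s)) \<le> C' / r"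
    using Suc[of "Suc j"] by blast
  show ?case
  proof (intro exI allI impI)
    fix r s :: real assume r: "r \<ge> 1"
    let ?V = "modulated_derivs B r z n"
    have "0 \<le> C' / r" using C'[OF r, of s] norm_ge_zero order_trans by blast
    then have "C' \<ge> 0" using r by (simp add: zero_le_divide_iff)
    then have "C' / r \<le> C'" using r mult_left_mono[of 1 r C'] by (simp add: divide_le_eq)
    have "norm (?V (Suc j) s) \<le> norm (complex_of_real (z ^ n * B (Suc j) s)) + C' / r"
      using C'[OF r, of s] norm_triangle_sub[of "?V (Suc j) s" "of_real (z ^ n * B (Suc j) s)"] by linarith
    also have "norm (complex_of_real (z ^ n * B (Suc j) s)) \<le> \<bar>z\<bar> ^ n * M (Suc j)"
      unfolding norm_of_real abs_mult power_abs by (intro mult_left_mono B) auto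
    also note \<open>C' / r \<le> C'\<close>
    finally have V: "norm (?V (Suc j) s) \<le> \<bar>z\<bar> ^ n * M (Suc j) + C'" by simp
    have "modulated_derivs B r z (Suc n) j s - of_real (z ^ Suc n * B j s)
        = of_real z * (?V j s - of_real (z ^ n * B j s)) - \<i> / of_real r * ?V (Suc j) s"
      by (simp add: algebra_simps)
    also have "norm \<dots> \<le> \<bar>z\<bar> * norm (?V j s - of_real (z ^ n * B j s)) + norm (?V (Suc j) s) / r"
      by (rule order_trans[OF norm_triangle_ineq4]) (use r in \<open>simp add: norm_mult norm_divide\<close>)
    also have "\<dots> \<le> \<bar>z\<bar> * (C / r) + (\<bar>z\<bar> ^ n * M (Suc j) + C') / r"
      using r by (intro add_mono mult_left_mono C[OF r] divide_right_mono V) auto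
    also have "\<dots> = (\<bar>z\<bar> * C + \<bar>z\<bar> ^ n * M (Suc j) + C') / r"
      by (simp add: add_divide_distrib)
    finally show "norm (modulated_derivs B r z (Suc n) j s - of_real (z ^ Suc n * B j s))
        \<le> (\<bar>z\<bar> * C + \<bar>z\<bar> ^ n * M (Suc j) + C') / r" .
  qed
qed

text \<open>One factor is exchanged at a time, by \<open>a P - b Q = a (P - Q) + (a - b) Q\<close>.
  Closeness and boundedness are proved in one induction, because the error estimate uses the bound
  on the product of the remaining \<open>b\<close>.\<close>

lemma prod_approx:
  fixes a b :: "'k \<Rightarrow> real \<Rightarrow> 'x \<Rightarrow> complex"
  assumes "finite K"
    and approx: "\<And>k. k \<in> K \<Longrightarrow> \<exists>C. \<forall>r\<ge>1. \<forall>x. norm (a k r x - b k r x) \<le> C / r"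
    and bound: "\<And>k. k \<in> K \<Longrightarrow> \<exists>A. \<forall>r\<ge>1. \<forall>x. norm (b k r x) \<le> A"
  shows "\<exists>C. \<forall>r\<ge>1. \<forall>x. norm ((\<Prod>k\<in>K. a k r x) - (\<Prod>k\<in>K. b k r x)) \<le> C / r"
    and "\<exists>A. \<forall>r\<ge>1. \<forall>x. norm (\<Prod>k\<in>K. b k r x) \<le> A"
proof -
  have "(\<exists>C. \<forall>r\<ge>1. \<forall>x. norm ((\<Prod>k\<in>K. a k r x) - (\<Prod>k\<in>K. b k r x)) \<le> C / r) \<and>
      (\<exists>A. \<forall>r\<ge>1. \<forall>x. norm (\<Prod>k\<in>K. b k r x) \<le> A)"
    using assms
  proof (induction K rule: finite_induct)
    case empty
    show ?case
    proof
      show "\<exists>C. \<forall>r\<ge>1. \<forall>x. norm ((\<Prod>k\<in>{}. a k r x) - (\<Prod>k\<in>{}. b k r x)) \<le> C / r"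
        by (rule exI[of _ 0]) simp
      show "\<exists>A. \<forall>r\<ge>1. \<forall>x. norm (\<Prod>k\<in>{}. b k r x) \<le> A" by (rule exI[of _ 1]) simp
    qed
  next
    case (insert k K)
    have IH: "(\<exists>C. \<forall>r\<ge>1. \<forall>x. norm ((\<Prod>k\<in>K. a k r x) - (\<Prod>k\<in>K. b k r x)) \<le> C / r) \<and>
        (\<exists>A. \<forall>r\<ge>1. \<forall>x. norm (\<Prod>k\<in>K. b k r x) \<le> A)"
      by (rule insert.IH; rule insert.prems; simp)
    obtain C where C: "\<And>r x. r \<ge> 1 \<Longrightarrow> norm ((\<Prod>k\<in>K. a k r x) - (\<Prod>k\<in>K. b k r x)) \<le> C / r"
      using IH by blast
    obtain A where A: "\<And>r x. r \<ge> 1 \<Longrightarrow> norm (\<Prod>k\<in>K. b k r x) \<le> A"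
      using IH by blast
    obtain C' where C': "\<And>r x. r \<ge> 1 \<Longrightarrow> norm (a k r x - b k r x) \<le> C' / r"
      using insert.prems(1)[of k] by auto
    obtain A' where A': "\<And>r x. r \<ge> 1 \<Longrightarrow> norm (b k r x) \<le> A'"
      using insert.prems(2)[of k] by auto
    have "norm ((\<Prod>k\<in>insert k K. a k r x) - (\<Prod>k\<in>insert k K. b k r x)) \<le> ((C' + A') * C + C' * A) / r"
      if r: "r \<ge> 1" for r x
    proof -
      let ?a = "\<Prod>k\<in>K. a k r x" and ?b = "\<Prod>k\<in>K. b k r x"
      have C'0: "0 \<le> C' / r" using C'[OF r, of x] norm_ge_zero order_trans by blast
      then have "C' \<ge> 0" using r by (simp add: zero_le_divide_iff)
      then have "C' / r \<le> C'" using r mult_left_mono[of 1 r C'] by (simp add: divide_le_eq)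
      then have a: "norm (a k r x) \<le> C' + A'"
        using C'[OF r, of x] A'[OF r, of x] norm_triangle_sub[of "a k r x" "b k r x"] by linarith
      have "(\<Prod>k\<in>insert k K. a k r x) - (\<Prod>k\<in>insert k K. b k r x)
          = a k r x * (?a - ?b) + (a k r x - b k r x) * ?b"
        using insert.hyps by (simp add: algebra_simps)
      also have "norm \<dots> \<le> norm (a k r x) * norm (?a - ?b) + norm (a k r x - b k r x) * norm ?b"
        by (rule order_trans[OF norm_triangle_ineq]) (simp add: norm_mult)
      also have "\<dots> \<le> (C' + A') * (C / r) + C' / r * A"
        using order_trans[OF norm_ge_zero a] C'0
        by (intro add_mono mult_mono C[OF r] C'[OF r] A[OF r] a) auto
      also have "\<dots> = ((C' + A') * C + C' * A) / r" by (simp add: add_divide_distrib)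
      finally show ?thesis .
    qed
    moreover have "norm (\<Prod>k\<in>insert k K. b k r x) \<le> A' * A" if r: "r \<ge> 1" for r x
      using insert.hyps order_trans[OF norm_ge_zero A'[OF r, of x]]
      by (simp add: norm_mult mult_mono A'[OF r] A[OF r])
    ultimately show ?case by blast
  qed
  then show "\<exists>C. \<forall>r\<ge>1. \<forall>x. norm ((\<Prod>k\<in>K. a k r x) - (\<Prod>k\<in>K. b k r x)) \<le> C / r"
    and "\<exists>A. \<forall>r\<ge>1. \<forall>x. norm (\<Prod>k\<in>K. b k r x) \<le> A" by auto
qed

section \<open>Symbols and truncated plane waves on R^n\<close>

definition monomial :: "('n::finite \<Rightarrow> nat) \<Rightarrow> real^'n \<Rightarrow> real" where
  "monomial \<alpha> \<xi> = (\<Prod>k\<in>UNIV. (\<xi> $ k) ^ \<alpha> k)"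

definition full_symbol :: "nat \<Rightarrow> (('n::finite \<Rightarrow> nat) \<Rightarrow> complex) \<Rightarrow> real^'n \<Rightarrow> complex" where
  "full_symbol l a \<xi> = (\<Sum>\<alpha> | order_mi \<alpha> \<le> l. a \<alpha> * of_real (monomial \<alpha> \<xi>))"

text \<open>\<open>f\<close> is the plane wave of frequency \<open>\<xi>\<close> times a bump
  stretched by \<open>r\<close> in every coordinate, on which \<open>D_mi \<alpha>\<close> acts as
  multiplication by the monomial up to order \<open>1 / r\<close>. The order of the quantifiers
  matters: \<open>c\<close> and \<open>A\<close> precede \<open>\<xi>\<close>, and only
  \<open>C\<close> may depend on it.\<close>

lemma oscillating_test_functions:
  obtains c A :: real where "c > 0" "A > 0"
    "\<And>(\<xi> :: real^'n::finite) l. \<exists>C\<ge>0. \<forall>r\<ge>1. \<exists>f \<in> test_functions.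
       (\<forall>x \<in> cube (r / 2). c \<le> norm (f x)) \<and>
       (\<forall>x. norm (f x) \<le> A * indicator (cube r) x) \<and>
       (\<forall>\<alpha>. D_mi \<alpha> f \<in> borel_measurable borel) \<and> f \<in> borel_measurable borel \<and>
       (\<forall>\<alpha> x. order_mi \<alpha> \<le> l \<longrightarrow>
          norm (D_mi \<alpha> f x - of_real (monomial \<alpha> \<xi>) * f x) \<le> C / r * indicator (cube r) x)"
proof -
  obtain B :: "nat \<Rightarrow> real \<Rightarrow> real" and c0 :: real and M :: "nat \<Rightarrow> real"
    where B: "\<And>j t. (B j has_real_derivative B (Suc j) t) (at t)"
      and supp: "\<And>j t. \<bar>t\<bar> \<ge> 1 \<Longrightarrow> B j t = 0"
      and bound: "\<And>j t. \<bar>B j t\<bar> \<le> M j"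
      and c0: "c0 > 0" "\<And>t. \<bar>t\<bar> \<le> 1/2 \<Longrightarrow> c0 \<le> B 0 t"
    by (rule bump_function_derivs) blast
  let ?n = "CARD('n)"
  have M0: "M 0 > 0" using bound[of 0 0] c0(1) c0(2)[of 0] by simp
  define W where "W r z j t = modulated_derivs B r z j 0 (t / r) * exp (\<i> * of_real (z * t))" for r z j t
  define F where "F r (\<xi> :: real^'n) = coord_prod (\<lambda>k. W r (\<xi> $ k))" for r \<xi>
  have W: "(W r z j has_vector_derivative \<i> * W r z (Suc j) t) (at t)" if r: "r \<ge> 1" for r z j t
  proof -
    have "((\<lambda>t. modulated_derivs B r z j 0 (t / r)) has_vector_derivative
        (1 / r) *\<^sub>R modulated_derivs B r z j (Suc 0) (t / r)) (at t)"
      using vector_diff_chain_at[of "\<lambda>t. t / r" "1 / r" t,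
          OF _ has_vector_derivative_modulated_derivs[where B=B and s="t / r", OF B]]
      by (simp add: o_def has_vector_derivative_divide[OF has_vector_derivative_id])
    moreover have "((\<lambda>t. exp (\<i> * of_real (z * t))) has_vector_derivative
        \<i> * of_real z * exp (\<i> * of_real (z * t))) (at t)"
    proof -
      have "((\<lambda>w. exp (\<i> * of_real z * w)) has_field_derivative \<i> * of_real z * exp (\<i> * of_real z * of_real t)) (at (of_real t))"
        by (auto intro!: derivative_eq_intros)
      from has_vector_derivative_real_field[OF this] show ?thesis by (simp add: mult_ac)
    qed
    ultimately have "(W r z j has_vector_derivative
        modulated_derivs B r z j 0 (t / r) * (\<i> * of_real z * exp (\<i> * of_real (z * t))) +
        (1 / r) *\<^sub>R modulated_derivs B r z j (Suc 0) (t / r) * exp (\<i> * of_real (z * t))) (at t)"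
      unfolding W_def by (rule has_vector_derivative_mult)
    moreover have "modulated_derivs B r z j 0 (t / r) * (\<i> * of_real z * exp (\<i> * of_real (z * t))) +
        (1 / r) *\<^sub>R modulated_derivs B r z j (Suc 0) (t / r) * exp (\<i> * of_real (z * t)) = \<i> * W r z (Suc j) t"
    proof -
      have "p * (\<i> * y * E) + (1 / r) *\<^sub>R p' * E = \<i> * ((y * p - \<i> / of_real r * p') * E)" for p p' y E :: complex
        by (simp add: scaleR_conv_of_real algebra_simps)
      then show ?thesis by (simp only: W_def modulated_derivs.simps)
    qed
    ultimately show ?thesis by simp
  qed
  have Wsupp: "W r z j t = 0" if "r \<ge> 1" "\<bar>t\<bar> > r" for r z j t
    using that modulated_derivs_eq_0[where B=B and s="t / r", OF supp] by (simp add: W_def)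
  have normexp: "norm (exp (\<i> * of_real y)) = 1" for y :: real
    by simp
  have normF0: "norm (F r \<xi> (\<lambda>_. 0) x) = (\<Prod>k\<in>UNIV. \<bar>B 0 (x $ k / r)\<bar>)" for r \<xi> x
    by (simp only: F_def coord_prod_def W_def prod_norm[symmetric] norm_mult normexp mult_1_right
        modulated_derivs.simps norm_of_real)
  have F0_le: "norm (F r \<xi> (\<lambda>_. 0) x) \<le> M 0 ^ ?n" for r \<xi> x
    unfolding normF0 using prod_mono[of UNIV "\<lambda>k. \<bar>B 0 (x $ k / r)\<bar>" "\<lambda>_. M 0"] bound by simp
  have F0_ge: "c0 ^ ?n \<le> norm (F r \<xi> (\<lambda>_. 0) x)" if "r \<ge> 1" "x \<in> cube (r / 2)" for r \<xi> x
  proof -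
    have "c0 \<le> \<bar>B 0 (x $ k / r)\<bar>" for k
    proof -
      have "\<bar>x $ k\<bar> \<le> r / 2" using that by (auto simp: cube_def)
      then have "\<bar>x $ k / r\<bar> \<le> 1 / 2" using that(1) by (simp add: field_simps)
      then show ?thesis using c0(2) by fastforce
    qed
    then show ?thesis
      unfolding normF0 using prod_mono[of UNIV "\<lambda>_. c0" "\<lambda>k. \<bar>B 0 (x $ k / r)\<bar>"] c0(1) by simp
  qed
  have F0supp: "F r \<xi> \<alpha> x = 0" if "r \<ge> 1" "x \<notin> cube r" for r \<xi> \<alpha> x
    unfolding F_def by (rule coord_prod_eq_0) (use that W Wsupp in auto)
  have DF: "D_mi \<alpha> (F r \<xi> (\<lambda>_. 0)) = F r \<xi> \<alpha>" if "r \<ge> 1" for r \<xi> \<alpha>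
    unfolding F_def by (rule D_mi_coord_prod) (rule W[OF that])
  have approx: "\<exists>C. \<forall>r\<ge>1. \<forall>x. norm (F r \<xi> \<alpha> x - of_real (monomial \<alpha> \<xi>) * F r \<xi> (\<lambda>_. 0) x) \<le> C / r" for \<xi> \<alpha>
  proof -
    \<comment> \<open>Coordinate by coordinate, \<open>a\<close> is the exact factor of the
      derivative and \<open>b\<close> is its leading term.\<close>
    define a where "a k r x = W r (\<xi> $ k) (\<alpha> k) (x $ k)" for k r and x :: "real^'n"
    define b where "b k r x = of_real (\<xi> $ k) ^ \<alpha> k * W r (\<xi> $ k) 0 (x $ k)" for k r and x :: "real^'n"
    have "\<exists>C. \<forall>r\<ge>1. \<forall>x. norm ((\<Prod>k\<in>UNIV. a k r x) - (\<Prod>k\<in>UNIV. b k r x)) \<le> C / r"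
    proof (rule prod_approx(1))
      fix k
      obtain C where C: "\<And>r s. r \<ge> 1 \<Longrightarrow>
          norm (modulated_derivs B r (\<xi> $ k) (\<alpha> k) 0 s - of_real ((\<xi> $ k) ^ \<alpha> k * B 0 s)) \<le> C / r"
        using modulated_derivs_approx[where B=B and M=M, OF bound] by blast
      have "norm (a k r x - b k r x) \<le> C / r" if "r \<ge> 1" for r x
      proof -
        have "a k r x - b k r x = (modulated_derivs B r (\<xi> $ k) (\<alpha> k) 0 (x $ k / r) - of_real ((\<xi> $ k) ^ \<alpha> k * B 0 (x $ k / r)))
            * exp (\<i> * of_real (\<xi> $ k * x $ k))"
          by (simp add: a_def b_def W_def algebra_simps)
        then have "norm (a k r x - b k r x) = norm (modulated_derivs B r (\<xi> $ k) (\<alpha> k) 0 (x $ k / r) - of_real ((\<xi> $ k) ^ \<alpha> k * B 0 (x $ k / r)))"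
          by (simp only: norm_mult normexp mult_1_right)
        then show ?thesis using C[OF that] by simp
      qed
      then show "\<exists>C. \<forall>r\<ge>1. \<forall>x. norm (a k r x - b k r x) \<le> C / r" by blast
      have "norm (b k r x) \<le> \<bar>\<xi> $ k\<bar> ^ \<alpha> k * M 0" for r x
        using bound[of 0 "x $ k / r"]
        by (simp only: b_def W_def norm_mult norm_power normexp mult_1_right modulated_derivs.simps norm_of_real)
          (intro mult_left_mono, auto)
      then show "\<exists>A. \<forall>r\<ge>1. \<forall>x. norm (b k r x) \<le> A" by blast
    qed simp
    then show ?thesis
      by (simp add: a_def b_def F_def coord_prod_def monomial_def prod.distrib)
  qed
  show ?thesis
  proof (rule that[of "c0 ^ ?n" "M 0 ^ ?n"])
    fix \<xi> :: "real^'n" and l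
    obtain C where C: "\<And>\<alpha> r x. r \<ge> 1 \<Longrightarrow> norm (F r \<xi> \<alpha> x - of_real (monomial \<alpha> \<xi>) * F r \<xi> (\<lambda>_. 0) x) \<le> C \<alpha> / r"
      using approx[of \<xi>] by metis
    let ?L = "{\<alpha> :: 'n \<Rightarrow> nat. order_mi \<alpha> \<le> l}"
    define D where "D = (\<Sum>\<alpha>\<in>?L. \<bar>C \<alpha>\<bar>)"
    have D: "C \<alpha> \<le> D" if "\<alpha> \<in> ?L" for \<alpha>
    proof -
      have "\<bar>C \<alpha>\<bar> \<le> D" unfolding D_def using that finite_order_mi_le by (intro member_le_sum) auto
      then show ?thesis by simp
    qed
    show "\<exists>C\<ge>0. \<forall>r\<ge>1. \<exists>f \<in> test_functions.
       (\<forall>x \<in> cube (r / 2). c0 ^ ?n \<le> norm (f x)) \<and>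
       (\<forall>x. norm (f x) \<le> M 0 ^ ?n * indicator (cube r) x) \<and>
       (\<forall>\<alpha>. D_mi \<alpha> f \<in> borel_measurable borel) \<and> f \<in> borel_measurable borel \<and>
       (\<forall>\<alpha> x. order_mi \<alpha> \<le> l \<longrightarrow>
          norm (D_mi \<alpha> f x - of_real (monomial \<alpha> \<xi>) * f x) \<le> C / r * indicator (cube r) x)"
    proof (intro exI[of _ D] conjI allI impI)
      show "0 \<le> D" by (simp add: D_def sum_nonneg)
      fix r :: real assume r: "r \<ge> 1"
      have meas: "F r \<xi> \<alpha> \<in> borel_measurable borel" for \<alpha>
        unfolding F_def by (rule borel_measurable_coord_prod) (rule W[OF r])
      show "\<exists>f \<in> test_functions.
       (\<forall>x \<in> cube (r / 2). c0 ^ ?n \<le> norm (f x)) \<and>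
       (\<forall>x. norm (f x) \<le> M 0 ^ ?n * indicator (cube r) x) \<and>
       (\<forall>\<alpha>. D_mi \<alpha> f \<in> borel_measurable borel) \<and> f \<in> borel_measurable borel \<and>
       (\<forall>\<alpha> x. order_mi \<alpha> \<le> l \<longrightarrow>
          norm (D_mi \<alpha> f x - of_real (monomial \<alpha> \<xi>) * f x) \<le> D / r * indicator (cube r) x)"
      proof (intro bexI[of _ "F r \<xi> (\<lambda>_. 0)"] conjI allI impI ballI)
        show "F r \<xi> (\<lambda>_. 0) \<in> test_functions"
          unfolding F_def by (rule coord_prod_in_test_functions) (rule W[OF r], rule Wsupp[OF r])
        show "norm (F r \<xi> (\<lambda>_. 0) x) \<le> M 0 ^ ?n * indicator (cube r) x" for x
          using F0_le F0supp[OF r] by (cases "x \<in> cube r") auto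
        show "norm (D_mi \<alpha> (F r \<xi> (\<lambda>_. 0)) x - of_real (monomial \<alpha> \<xi>) * F r \<xi> (\<lambda>_. 0) x)
            \<le> D / r * indicator (cube r) x" if "order_mi \<alpha> \<le> l" for \<alpha> x
        proof (cases "x \<in> cube r")
          case True
          have "C \<alpha> / r \<le> D / r" using D[of \<alpha>] that r by (intro divide_right_mono) auto
          then show ?thesis using True C[OF r, of \<alpha> x] DF[OF r] by simp
        qed (use F0supp[OF r] DF[OF r] in simp)
      qed (use F0_ge r DF meas in auto)
    qed
  qed (use c0(1) M0 in auto)
qed

section \<open>Symbols of weakly coercive systems\<close>

text \<open>In the coercivity inequality for truncated plane waves, each norm is compared with the
  \<open>Lp_factor\<close> of a cube. This common size cancels, and for \<open>r\<close> tending to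
  infinity only symbols remain, with a constant free of \<open>\<xi>\<close>.\<close>

lemma weakly_coercive_symbol_bound:
  fixes a :: "'m::finite \<Rightarrow> ('n::finite \<Rightarrow> nat) \<Rightarrow> complex"
  assumes p: "1 \<le> p" and wc: "weakly_coercive p l a"
  shows "\<exists>K. \<forall>\<xi>. (\<Sum>\<alpha> | order_mi \<alpha> < l. \<bar>monomial \<alpha> \<xi>\<bar>)
    \<le> K * ((\<Sum>j\<in>UNIV. norm (full_symbol l (a j) \<xi>)) + 1)"
proof -
  obtain C1 C2 where wc: "\<And>f. f \<in> test_functions \<Longrightarrow>
      (\<Sum>\<alpha> | order_mi \<alpha> < l. Lp_norm p (D_mi \<alpha> f))
        \<le> C1 * (\<Sum>j\<in>UNIV. Lp_norm p (diff_op l (a j) f)) + C2 * Lp_norm p f"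
    using wc by (auto simp: weakly_coercive_def)
  obtain c A :: real where cA: "c > 0" "A > 0"
    and test: "\<And>(\<xi> :: real^'n) l. \<exists>C\<ge>0. \<forall>r\<ge>1. \<exists>f \<in> test_functions.
       (\<forall>x \<in> cube (r / 2). c \<le> norm (f x)) \<and>
       (\<forall>x. norm (f x) \<le> A * indicator (cube r) x) \<and>
       (\<forall>\<alpha>. D_mi \<alpha> f \<in> borel_measurable borel) \<and> f \<in> borel_measurable borel \<and>
       (\<forall>\<alpha> x. order_mi \<alpha> \<le> l \<longrightarrow>
          norm (D_mi \<alpha> f x - of_real (monomial \<alpha> \<xi>) * f x) \<le> C / r * indicator (cube r) x)"
    by (rule oscillating_test_functions[where 'n='n]) blast
  let ?L = "{\<alpha> :: 'n \<Rightarrow> nat. order_mi \<alpha> < l}" and ?L' = "{\<alpha> :: 'n \<Rightarrow> nat. order_mi \<alpha> \<le> l}"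
  have Lnn: "Lp_norm p f \<ge> 0" for f :: "real^'n \<Rightarrow> complex" by (simp add: Lp_norm_def)
  define S where "S \<xi> = (\<Sum>\<alpha>\<in>?L. \<bar>monomial \<alpha> \<xi>\<bar>)" for \<xi> :: "real^'n"
  define T where "T \<xi> = (\<Sum>j\<in>UNIV. norm (full_symbol l (a j) \<xi>))" for \<xi>
  define N where "N = (\<Sum>j\<in>UNIV. \<Sum>\<alpha>\<in>?L'. norm (a j \<alpha>))"
  have bound: "c * S \<xi> \<le> 2 ^ CARD('n) * (\<bar>C1\<bar> * A * T \<xi> + \<bar>C2\<bar> * A)" for \<xi>
  proof -
    obtain C where C0: "C \<ge> 0" and C: "\<And>r. r \<ge> 1 \<Longrightarrow> \<exists>f \<in> test_functions.
       (\<forall>x \<in> cube (r / 2). c \<le> norm (f x)) \<and>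
       (\<forall>x. norm (f x) \<le> A * indicator (cube r) x) \<and>
       (\<forall>\<alpha>. D_mi \<alpha> f \<in> borel_measurable borel) \<and> f \<in> borel_measurable borel \<and>
       (\<forall>\<alpha> x. order_mi \<alpha> \<le> l \<longrightarrow>
          norm (D_mi \<alpha> f x - of_real (monomial \<alpha> \<xi>) * f x) \<le> C / r * indicator (cube r) x)"
      using test[of l \<xi>] by blast
    have main: "(\<Sum>\<alpha>\<in>?L. \<bar>monomial \<alpha> \<xi>\<bar> * c - C / r)
        \<le> 2 ^ CARD('n) * (\<bar>C1\<bar> * (A * T \<xi> + N * (C / r)) + \<bar>C2\<bar> * A)" if r: "r \<ge> 1" for r
    proof -
      obtain f where f: "f \<in> test_functions"
        and ge: "\<And>x. x \<in> cube (r / 2) \<Longrightarrow> c \<le> norm (f x)"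
        and le: "\<And>x. norm (f x) \<le> A * indicator (cube r) x"
        and meas: "\<And>\<alpha>. D_mi \<alpha> f \<in> borel_measurable borel" "f \<in> borel_measurable borel"
        and err: "\<And>\<alpha> x. order_mi \<alpha> \<le> l \<Longrightarrow>
          norm (D_mi \<alpha> f x - of_real (monomial \<alpha> \<xi>) * f x) \<le> C / r * indicator (cube r) x"
        using C[OF r] by blast
      let ?v = "Lp_factor p (cube r :: (real^'n) set)" and ?w = "Lp_factor p (cube (r / 2) :: (real^'n) set)"
      have v: "?v > 0" "?w > 0" "?v \<le> 2 ^ CARD('n) * ?w"
        using r p by (auto intro!: Lp_factor_cube_pos Lp_factor_cube_half)
      have Q: "cube r \<in> sets lborel" "emeasure lborel (cube r :: (real^'n) set) < \<infinity>" if "r \<ge> 0" for r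
        using that by (auto simp: emeasure_cube)
      \<comment> \<open>On the half cube the leading term dominates the error; where the claimed
        bound is negative it holds trivially.\<close>
      have lower: "(\<bar>monomial \<alpha> \<xi>\<bar> * c - C / r) * ?w \<le> Lp_norm p (D_mi \<alpha> f)" if \<alpha>: "\<alpha> \<in> ?L" for \<alpha>
      proof (cases "\<bar>monomial \<alpha> \<xi>\<bar> * c - C / r \<ge> 0")
        case True
        show ?thesis
        proof (rule Lp_norm_ge[OF p meas(1) Q _ Q _ True])
          show "emeasure lborel (cube (r / 2) :: (real^'n) set) \<noteq> 0"
            using r by (simp add: emeasure_cube)
          show "norm (D_mi \<alpha> f x) \<le> (\<bar>monomial \<alpha> \<xi>\<bar> * A + C / r) * indicator (cube r) x" for x
          proof -
            have "norm (D_mi \<alpha> f x) \<le> norm (of_real (monomial \<alpha> \<xi>) * f x) + norm (D_mi \<alpha> f x - of_real (monomial \<alpha> \<xi>) * f x)"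
              by (rule norm_triangle_sub)
            also have "\<dots> \<le> \<bar>monomial \<alpha> \<xi>\<bar> * (A * indicator (cube r) x) + C / r * indicator (cube r) x"
              unfolding norm_mult norm_of_real using \<alpha> by (intro add_mono mult_left_mono le err) auto
            finally show ?thesis by (simp add: algebra_simps)
          qed
          show "\<bar>monomial \<alpha> \<xi>\<bar> * c - C / r \<le> norm (D_mi \<alpha> f x)" if x: "x \<in> cube (r / 2)" for x
          proof -
            have "\<bar>x $ k\<bar> \<le> r" for k
            proof -
              have "\<bar>x $ k\<bar> \<le> r / 2" using x by (simp add: cube_def)
              then show ?thesis using r by linarith
            qed
            then have "x \<in> cube r" by (simp add: cube_def)
            then have "norm (D_mi \<alpha> f x - of_real (monomial \<alpha> \<xi>) * f x) \<le> C / r"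
              using err[of \<alpha> x] \<alpha> by simp
            moreover have "\<bar>monomial \<alpha> \<xi>\<bar> * c \<le> norm (of_real (monomial \<alpha> \<xi>) * f x)"
              unfolding norm_mult norm_of_real by (intro mult_left_mono ge x) auto
            moreover have "norm (of_real (monomial \<alpha> \<xi>) * f x) \<le> norm (D_mi \<alpha> f x) + norm (D_mi \<alpha> f x - of_real (monomial \<alpha> \<xi>) * f x)"
              by (metis norm_minus_commute norm_triangle_sub)
            ultimately show ?thesis by linarith
          qed
        qed (use r in auto)
      next
        case False
        then show ?thesis using v Lnn[of "D_mi \<alpha> f"]
          by (meson less_eq_real_def mult_nonpos_nonneg not_le order_trans)
      qed
      have upper: "Lp_norm p (diff_op l (a j) f)
          \<le> (norm (full_symbol l (a j) \<xi>) * A + (\<Sum>\<alpha>\<in>?L'. norm (a j \<alpha>)) * (C / r)) * ?v" for j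
      proof (rule Lp_norm_le[OF p _ Q])
        show "diff_op l (a j) f \<in> borel_measurable borel"
          unfolding diff_op_def using meas by measurable
        show "0 \<le> norm (full_symbol l (a j) \<xi>) * A + (\<Sum>\<alpha>\<in>?L'. norm (a j \<alpha>)) * (C / r)"
          using cA C0 r by (intro add_nonneg_nonneg mult_nonneg_nonneg sum_nonneg) auto
        fix x
        \<comment> \<open>The operator acts as its full symbol, plus errors weighted by the
          coefficients.\<close>
        have "diff_op l (a j) f x = full_symbol l (a j) \<xi> * f x
            + (\<Sum>\<alpha>\<in>?L'. a j \<alpha> * (D_mi \<alpha> f x - of_real (monomial \<alpha> \<xi>) * f x))"
          by (simp add: diff_op_def full_symbol_def algebra_simps sum_subtractf sum_distrib_left)
        also have "norm \<dots> \<le> norm (full_symbol l (a j) \<xi> * f x)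
            + (\<Sum>\<alpha>\<in>?L'. norm (a j \<alpha> * (D_mi \<alpha> f x - of_real (monomial \<alpha> \<xi>) * f x)))"
          by (rule order_trans[OF norm_triangle_ineq add_left_mono[OF norm_sum]])
        also have "\<dots> \<le> norm (full_symbol l (a j) \<xi>) * (A * indicator (cube r) x)
            + (\<Sum>\<alpha>\<in>?L'. norm (a j \<alpha>) * (C / r * indicator (cube r) x))"
          unfolding norm_mult by (intro add_mono sum_mono mult_left_mono le err) auto
        also have "\<dots> = (norm (full_symbol l (a j) \<xi>) * A + (\<Sum>\<alpha>\<in>?L'. norm (a j \<alpha>)) * (C / r)) * indicator (cube r) x"
          by (simp only: distrib_right sum_distrib_right mult.assoc)
        finally show "norm (diff_op l (a j) f x)
            \<le> (norm (full_symbol l (a j) \<xi>) * A + (\<Sum>\<alpha>\<in>?L'. norm (a j \<alpha>)) * (C / r)) * indicator (cube r) x" .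
      qed (use r in auto)
      have upper_f: "Lp_norm p f \<le> A * ?v"
        by (rule Lp_norm_le[OF p meas(2) Q _ le]) (use r cA in auto)
      have "(\<Sum>\<alpha>\<in>?L. \<bar>monomial \<alpha> \<xi>\<bar> * c - C / r) * ?w \<le> (\<Sum>\<alpha>\<in>?L. Lp_norm p (D_mi \<alpha> f))"
        unfolding sum_distrib_right by (rule sum_mono[OF lower])
      also have "\<dots> \<le> C1 * (\<Sum>j\<in>UNIV. Lp_norm p (diff_op l (a j) f)) + C2 * Lp_norm p f"
        by (rule wc[OF f])
      \<comment> \<open>The constants may be negative, so absolute values come before the upper
        estimates of the norms.\<close>
      also have "\<dots> \<le> \<bar>C1\<bar> * (\<Sum>j\<in>UNIV. Lp_norm p (diff_op l (a j) f)) + \<bar>C2\<bar> * Lp_norm p f"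
        using Lnn by (intro add_mono mult_right_mono sum_nonneg) auto
      also have "\<dots> \<le> \<bar>C1\<bar> * (\<Sum>j\<in>UNIV. (norm (full_symbol l (a j) \<xi>) * A + (\<Sum>\<alpha>\<in>?L'. norm (a j \<alpha>)) * (C / r)) * ?v)
          + \<bar>C2\<bar> * (A * ?v)"
        by (intro add_mono mult_left_mono sum_mono upper upper_f) auto
      also have "\<dots> = (\<bar>C1\<bar> * (A * T \<xi> + N * (C / r)) + \<bar>C2\<bar> * A) * ?v"
        by (simp add: T_def N_def sum_distrib_right sum.distrib algebra_simps flip: sum_distrib_left sum_divide_distrib)
      also have "\<dots> \<le> (\<bar>C1\<bar> * (A * T \<xi> + N * (C / r)) + \<bar>C2\<bar> * A) * (2 ^ CARD('n) * ?w)"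
        using cA C0 r by (intro mult_left_mono v(3) add_nonneg_nonneg mult_nonneg_nonneg)
          (auto simp: T_def N_def intro!: sum_nonneg)
      finally have "(\<Sum>\<alpha>\<in>?L. \<bar>monomial \<alpha> \<xi>\<bar> * c - C / r) * ?w
          \<le> 2 ^ CARD('n) * (\<bar>C1\<bar> * (A * T \<xi> + N * (C / r)) + \<bar>C2\<bar> * A) * ?w" by (simp only: mult_ac)
      then show ?thesis using v(2) by (simp only: mult_le_cancel_right_pos)
    qed
    have lim0: "((\<lambda>r. C / r) \<longlongrightarrow> 0) at_top"
      by (rule real_tendsto_divide_at_top[OF tendsto_const filterlim_ident])
    \<comment> \<open>\<open>C\<close> depends on \<open>\<xi>\<close>, so the limit in
      \<open>r\<close> is taken at fixed \<open>\<xi>\<close>; it removes every occurrence of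
      \<open>C\<close>.\<close>
    have "(\<Sum>\<alpha>\<in>?L. \<bar>monomial \<alpha> \<xi>\<bar> * c - 0)
        \<le> 2 ^ CARD('n) * (\<bar>C1\<bar> * (A * T \<xi> + N * 0) + \<bar>C2\<bar> * A)"
    proof (rule tendsto_le)
      show "((\<lambda>r. 2 ^ CARD('n) * (\<bar>C1\<bar> * (A * T \<xi> + N * (C / r)) + \<bar>C2\<bar> * A)) \<longlongrightarrow>
          2 ^ CARD('n) * (\<bar>C1\<bar> * (A * T \<xi> + N * 0) + \<bar>C2\<bar> * A)) at_top"
        by (intro tendsto_intros lim0)
      show "((\<lambda>r. \<Sum>\<alpha>\<in>?L. \<bar>monomial \<alpha> \<xi>\<bar> * c - C / r) \<longlongrightarrow> (\<Sum>\<alpha>\<in>?L. \<bar>monomial \<alpha> \<xi>\<bar> * c - 0)) at_top"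
        by (intro tendsto_intros lim0)
      show "\<forall>\<^sub>F r in at_top. (\<Sum>\<alpha>\<in>?L. \<bar>monomial \<alpha> \<xi>\<bar> * c - C / r)
          \<le> 2 ^ CARD('n) * (\<bar>C1\<bar> * (A * T \<xi> + N * (C / r)) + \<bar>C2\<bar> * A)"
        using eventually_ge_at_top[of 1] by eventually_elim (rule main)
    qed simp
    then show ?thesis by (simp add: S_def sum_distrib_left mult_ac)
  qed
  define K where "K = 2 ^ CARD('n) * (\<bar>C1\<bar> * A + \<bar>C2\<bar> * A) / c"
  have "S \<xi> \<le> K * (T \<xi> + 1)" for \<xi>
  proof -
    have "T \<xi> \<ge> 0" by (simp add: T_def sum_nonneg)
    then have "\<bar>C1\<bar> * A * T \<xi> + \<bar>C2\<bar> * A \<le> (\<bar>C1\<bar> * A + \<bar>C2\<bar> * A) * (T \<xi> + 1)"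
      using cA by (simp add: algebra_simps)
    then have "2 ^ CARD('n) * (\<bar>C1\<bar> * A * T \<xi> + \<bar>C2\<bar> * A) \<le> 2 ^ CARD('n) * ((\<bar>C1\<bar> * A + \<bar>C2\<bar> * A) * (T \<xi> + 1))"
      by (intro mult_left_mono) auto
    with bound[of \<xi>] have "c * S \<xi> \<le> 2 ^ CARD('n) * ((\<bar>C1\<bar> * A + \<bar>C2\<bar> * A) * (T \<xi> + 1))" by (rule order_trans)
    then have "S \<xi> \<le> 2 ^ CARD('n) * ((\<bar>C1\<bar> * A + \<bar>C2\<bar> * A) * (T \<xi> + 1)) / c"
      using cA by (simp add: pos_le_divide_eq mult_ac)
    then show ?thesis by (simp add: K_def)
  qed
  then show ?thesis unfolding S_def T_def by blast
qed

text \<open>At a common zero the right side of the symbol bound is the constant \<open>K\<close>,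
  and \<open>l \<ge> 2\<close> puts the coordinates of \<open>\<xi>\<close>, as monomials of order
  1, among the terms on the left.\<close>

lemma full_symbol_common_zeros_bounded:
  fixes a :: "'m::finite \<Rightarrow> ('n::finite \<Rightarrow> nat) \<Rightarrow> complex"
  assumes "1 \<le> p" "weakly_coercive p l a" "l \<ge> 2"
  shows "\<exists>R. \<forall>\<xi>. (\<forall>j. full_symbol l (a j) \<xi> = 0) \<longrightarrow> norm \<xi> \<le> R"
proof -
  obtain K where K: "\<And>\<xi>. (\<Sum>\<alpha> | order_mi \<alpha> < l. \<bar>monomial \<alpha> \<xi>\<bar>)
    \<le> K * ((\<Sum>j\<in>UNIV. norm (full_symbol l (a j) \<xi>)) + 1)"
    using weakly_coercive_symbol_bound[OF assms(1,2)] by blast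
  have "norm \<xi> \<le> CARD('n) * K" if z: "\<forall>j. full_symbol l (a j) \<xi> = 0" for \<xi>
  proof -
    have fin: "finite {\<alpha> :: 'n \<Rightarrow> nat. order_mi \<alpha> < l}"
      by (rule finite_subset[OF _ finite_order_mi_le[of l]]) auto
    have "\<bar>\<xi> $ k\<bar> \<le> K" for k
    proof -
      define \<alpha> :: "'n \<Rightarrow> nat" where "\<alpha> = (\<lambda>j. if j = k then 1 else 0)"
      have "order_mi \<alpha> = 1" by (simp add: order_mi_def \<alpha>_def)
      then have "\<bar>monomial \<alpha> \<xi>\<bar> \<le> (\<Sum>\<alpha> | order_mi \<alpha> < l. \<bar>monomial \<alpha> \<xi>\<bar>)"
        using assms(3) fin by (intro member_le_sum) auto
      also have "\<dots> \<le> K" using K[of \<xi>] z by simp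
      also have "monomial \<alpha> \<xi> = \<xi> $ k"
        by (simp add: monomial_def \<alpha>_def if_distrib[of "power _"] cong: if_cong)
      finally show ?thesis .
    qed
    then have "(\<Sum>k\<in>UNIV. \<bar>\<xi> $ k\<bar>) \<le> CARD('n) * K"
      using sum_bounded_above[of UNIV "\<lambda>k. \<bar>\<xi> $ k\<bar>" K] by simp
    then show ?thesis using norm_le_l1_cart[of \<xi>] by linarith
  qed
  then show ?thesis by blast
qed

section \<open>Homogenised symbols and the choice of a generic hyperplane\<close>

definition homogenized_symbol ::
  "nat \<Rightarrow> (('n::finite \<Rightarrow> nat) \<Rightarrow> complex) \<Rightarrow> real \<Rightarrow> real^'n \<Rightarrow> complex" where
  "homogenized_symbol l a s \<xi> =
     (\<Sum>\<alpha> | order_mi \<alpha> \<le> l. a \<alpha> * of_real (s ^ (l - order_mi \<alpha>) * monomial \<alpha> \<xi>))"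

lemma monomial_scaleR: "monomial \<alpha> (c *\<^sub>R \<xi>) = c ^ order_mi \<alpha> * monomial \<alpha> \<xi>"
  by (simp add: monomial_def order_mi_def power_mult_distrib prod.distrib power_sum)

lemma homogenized_symbol_scaleR:
  "homogenized_symbol l a (c * s) (c *\<^sub>R \<xi>) = of_real (c ^ l) * homogenized_symbol l a s \<xi>"
proof -
  have "(c * s) ^ (l - order_mi \<alpha>) * monomial \<alpha> (c *\<^sub>R \<xi>) = c ^ l * (s ^ (l - order_mi \<alpha>) * monomial \<alpha> \<xi>)"
    if "order_mi \<alpha> \<le> l" for \<alpha>
  proof -
    have "c ^ l = c ^ (l - order_mi \<alpha>) * c ^ order_mi \<alpha>" using that by (simp flip: power_add)
    then show ?thesis by (simp add: monomial_scaleR power_mult_distrib)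
  qed
  then show ?thesis
    unfolding homogenized_symbol_def sum_distrib_left by (intro sum.cong) auto
qed

lemma homogenized_symbol_1: "homogenized_symbol l a 1 = full_symbol l a"
  by (simp add: homogenized_symbol_def full_symbol_def fun_eq_iff)

text \<open>The powers of 0 are 0 for lower-order terms, and \<open>0 ^ 0 = 1\<close> keeps those of
  order \<open>l\<close>.\<close>

lemma homogenized_symbol_0: "homogenized_symbol l a 0 = principal_symbol l a"
proof
  fix \<xi>
  have "homogenized_symbol l a 0 \<xi> = (\<Sum>\<alpha> | order_mi \<alpha> = l. a \<alpha> * of_real (0 ^ (l - order_mi \<alpha>) * monomial \<alpha> \<xi>))"
    unfolding homogenized_symbol_def
    by (rule sum.mono_neutral_right[OF finite_order_mi_le]) auto
  also have "\<dots> = principal_symbol l a \<xi>"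
    unfolding principal_symbol_def monomial_def by (intro sum.cong) auto
  finally show "homogenized_symbol l a 0 \<xi> = principal_symbol l a \<xi>" .
qed

lemma homogenized_symbol_linear_differentiable:
  fixes w :: "real^'n::finite"
  shows "(\<lambda>\<xi>. Re (homogenized_symbol l a (w \<bullet> \<xi>) \<xi>)) differentiable_on UNIV"
    and "(\<lambda>\<xi>. Im (homogenized_symbol l a (w \<bullet> \<xi>) \<xi>)) differentiable_on UNIV"
proof -
  have poly: "real_polynomial_function (\<lambda>\<xi>. (w \<bullet> \<xi>) ^ m * monomial \<alpha> \<xi>)" for m and \<alpha> :: "'n \<Rightarrow> nat"
    unfolding monomial_def
    by (intro real_polynomial_function.intros real_polynomial_function_power real_polynomial_function_prod
        bounded_linear_inner_right bounded_linear_vec_nth) auto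
  have "real_polynomial_function (\<lambda>\<xi>. \<Sum>\<alpha> | order_mi \<alpha> \<le> l. b \<alpha> * ((w \<bullet> \<xi>) ^ (l - order_mi \<alpha>) * monomial \<alpha> \<xi>))"
    for b :: "('n \<Rightarrow> nat) \<Rightarrow> real"
    by (intro real_polynomial_function_sum finite_order_mi_le real_polynomial_function.intros(2,4) poly)
  then have diff: "(\<lambda>\<xi>. \<Sum>\<alpha> | order_mi \<alpha> \<le> l. b \<alpha> * ((w \<bullet> \<xi>) ^ (l - order_mi \<alpha>) * monomial \<alpha> \<xi>)) differentiable_on UNIV"
    for b :: "('n \<Rightarrow> nat) \<Rightarrow> real"
    by (rule differentiable_on_real_polynomial_function)
  show "(\<lambda>\<xi>. Re (homogenized_symbol l a (w \<bullet> \<xi>) \<xi>)) differentiable_on UNIV"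
    using diff[of "\<lambda>\<alpha>. Re (a \<alpha>)"] by (simp add: homogenized_symbol_def)
  show "(\<lambda>\<xi>. Im (homogenized_symbol l a (w \<bullet> \<xi>) \<xi>)) differentiable_on UNIV"
    using diff[of "\<lambda>\<alpha>. Im (a \<alpha>)"] by (simp add: homogenized_symbol_def)
qed

text \<open>Each \<open>z\<close> excludes only a hyperplane of vectors \<open>w\<close>, a null
  set, and finitely many null sets do not cover the space.\<close>

lemma inner_nonzero_on_finite:
  fixes Z :: "'a::euclidean_space set"
  assumes "finite Z" "0 \<notin> Z"
  shows "\<exists>w. \<forall>z\<in>Z. w \<bullet> z \<noteq> 0"
proof -
  have "negligible {w. z \<bullet> w = 0}" if "z \<in> Z" for z
    using that assms(2) by (intro negligible_hyperplane) auto
  then have "negligible (\<Union>z\<in>Z. {w. z \<bullet> w = 0})" using assms(1) by (intro negligible_Union) auto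
  then have "(\<Union>z\<in>Z. {w. z \<bullet> w = 0}) \<noteq> UNIV" using non_negligible_UNIV by metis
  then show ?thesis by (auto simp: inner_commute)
qed

section \<open>Parity of the order of a weakly coercive system\<close>

theorem theorem4p3:
  fixes p :: ennreal
    and l :: nat
    and a :: "'m::finite \<Rightarrow> ('n::finite \<Rightarrow> nat) \<Rightarrow> complex"
  assumes "1 \<le> p"
    and "l \<noteq> 1"
    and "weakly_coercive p l a"
    and "CARD('n) \<ge> 2 * CARD('m) + 1"
    and "finite {\<xi> \<in> sphere (0 :: real^'n) 1. principal_map l a \<xi> = 0}"
  shows "even l"
proof (rule ccontr)
  assume odd: "odd l"
  \<comment> \<open>Oddness excludes 0, so with \<open>l \<noteq> 1\<close> the order is large
    enough for the common zeros of the full symbols to be bounded.\<close>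
  with assms(2) have "l \<ge> 2" by (cases l) auto
  with full_symbol_common_zeros_bounded[OF assms(1,3)] obtain R
    where R: "\<And>\<xi>. (\<And>j. full_symbol l (a j) \<xi> = 0) \<Longrightarrow> norm \<xi> \<le> R" by blast
  let ?Z = "{\<xi> \<in> sphere (0 :: real^'n) 1. principal_map l a \<xi> = 0}"
  obtain w0 :: "real^'n" where w0: "\<And>z. z \<in> ?Z \<Longrightarrow> w0 \<bullet> z \<noteq> 0"
    using inner_nonzero_on_finite[OF assms(5)] by auto
  \<comment> \<open>so small that \<^term>\<open>\<bar>w \<bullet> \<xi>\<bar> * (\<bar>R\<bar> + 1) < 1\<close> on the unit sphere\<close>
  define w where "w = (1 / ((\<bar>R\<bar> + 1) * (norm w0 + 1))) *\<^sub>R w0"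
  have w: "w \<bullet> z \<noteq> 0" if "z \<in> ?Z" for z
    using w0[OF that] by (simp add: w_def) (metis abs_ge_zero add_nonneg_eq_0_iff norm_ge_zero zero_le_one zero_neq_one)
  have wR: "norm w * (\<bar>R\<bar> + 1) < 1"
  proof -
    have "norm w * (\<bar>R\<bar> + 1) = norm w0 / (norm w0 + 1)"
      by (simp add: w_def)
    also have "\<dots> < 1"
    proof -
      have "norm w0 + 1 > 0" using norm_ge_zero[of w0] by linarith
      then show ?thesis by simp
    qed
    finally show ?thesis .
  qed
  \<comment> \<open>Tying the homogenising variable to \<open>w \<bullet> \<xi>\<close> gives a map
    homogeneous of degree \<open>l\<close> in \<open>\<xi>\<close> alone.\<close>
  define G :: "real^'n \<Rightarrow> real^('m + 'm)" where
    "G \<xi> = (\<chi> i. case i of Inl j \<Rightarrow> Re (homogenized_symbol l (a j) (w \<bullet> \<xi>) \<xi>)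
                        | Inr j \<Rightarrow> Im (homogenized_symbol l (a j) (w \<bullet> \<xi>) \<xi>))" for \<xi>
  have "\<exists>\<xi>. norm \<xi> = 1 \<and> G \<xi> = 0"
  proof (rule homogeneous_odd_common_zero[OF _ odd])
    show "CARD('m + 'm) < CARD('n)" using assms(4) by simp
    show "G differentiable_on UNIV" unfolding G_def
    proof (rule differentiable_on_vec_lambda)
      show "(\<lambda>\<xi>. case i of Inl j \<Rightarrow> Re (homogenized_symbol l (a j) (w \<bullet> \<xi>) \<xi>)
          | Inr j \<Rightarrow> Im (homogenized_symbol l (a j) (w \<bullet> \<xi>) \<xi>)) differentiable_on UNIV" for i
        by (cases i) (simp_all add: homogenized_symbol_linear_differentiable)
    qed
    show "G (c *\<^sub>R x) = c ^ l *\<^sub>R G x" for c x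
      by (simp add: G_def vec_eq_iff homogenized_symbol_scaleR flip: of_real_power split: sum.split)
  qed
  then obtain \<xi> where \<xi>: "norm \<xi> = 1" "G \<xi> = 0" by blast
  have zero: "homogenized_symbol l (a j) (w \<bullet> \<xi>) \<xi> = 0" for j
    using arg_cong[OF \<xi>(2), of "\<lambda>v. v $ Inl j"] arg_cong[OF \<xi>(2), of "\<lambda>v. v $ Inr j"]
    by (simp add: G_def complex_eq_iff)
  show False
  \<comment> \<open>If \<open>w \<bullet> \<xi> = 0\<close>, then \<open>\<xi>\<close> is a zero of
    the principal map on the sphere, and \<open>w\<close> is orthogonal to none of those. Otherwise
    division by \<open>s = w \<bullet> \<xi>\<close> produces a common zero of the full symbols with
    norm \<open>1 / \<bar>s\<bar>\<close>, too large for the bound \<open>R\<close> because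
    \<open>w\<close> is small.\<close>
  proof (cases "w \<bullet> \<xi> = 0")
    case True
    then have "principal_map l a \<xi> = 0"
      using zero by (simp add: homogenized_symbol_0 principal_map_def vec_eq_iff split: sum.split)
    then show False using w[of \<xi>] \<xi>(1) True by simp
  next
    case False
    define s where "s = w \<bullet> \<xi>"
    have "s \<noteq> 0" using False by (simp add: s_def)
    have "full_symbol l (a j) ((1 / s) *\<^sub>R \<xi>) = 0" for j
      using homogenized_symbol_scaleR[of l "a j" "1 / s" s \<xi>] zero[of j] \<open>s \<noteq> 0\<close>
      by (simp add: homogenized_symbol_1 s_def)
    then have "1 / \<bar>s\<bar> \<le> R" using R[of "(1 / s) *\<^sub>R \<xi>"] \<xi>(1) by simp
    then have "1 \<le> R * \<bar>s\<bar>" using \<open>s \<noteq> 0\<close> by (simp add: divide_le_eq)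
    also have "\<dots> \<le> (\<bar>R\<bar> + 1) * \<bar>s\<bar>" by (intro mult_right_mono) auto
    finally have "1 \<le> \<bar>s\<bar> * (\<bar>R\<bar> + 1)" by (simp only: mult.commute)
    moreover have "\<bar>s\<bar> \<le> norm w" using Cauchy_Schwarz_ineq2[of w \<xi>] \<xi>(1) by (simp add: s_def)
    then have "\<bar>s\<bar> * (\<bar>R\<bar> + 1) \<le> norm w * (\<bar>R\<bar> + 1)" by (intro mult_right_mono) auto
    ultimately show False using wR by linarith
  qed
qed

end
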